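(* Let $\ell=tp^n+k$ with integers $t\ge 0$, $1\le k\le p^n$, and suppose $\max(r+s-p^{n+1},0)+1\le\ell\le\min(r,s)$ and $\min(R,S)>0$. Assume that $R<S$, $t\le\min(r_n-1,s_n)$, and $R+1\le k\le S$. Then $\lambda_\ell=(r_n+s_n-2t)p^n$, so $(g-1)^{(r_n+s_n-2t-1)p^n}$ maps $D_{(r_n+s_n-t)p^n+R+S-k}$ to $D_{(t+1)p^n+R+S-k}$, and the following hold. (1) Define $z_\ell\in D_{(t+1)p^n+R+S-k}$ by \[z_\ell=(-1)^{R}\sum_{i=0}^t(-1)^{i+k-1}v_{(i+1)p^n+R+1-k,\,(t-i)p^n+S}.\] Then $(g-1)^{p^n-1}(z_\ell)=x_{tp^n+R+S+1-k}$. (2) Let $P$ be the $(t+1)\times(t+1)$ matrix over $F$ with $(i,j)$ entry $\binom{r_n+s_n-2t-1}{r_n-t+j-i-1}$ (which is invertible), let $X$ be the $(t+1)\times1$ matrix with $(i,1)$ entry $(-1)^{i-1}$, and let $\zeta=P^{-1}X$. Define $y_\ell\in D_{(r_n+s_n-t)p^n+R+S-k}$ by \[y_\ell=(-1)^{R+k-1}\sum_{i=0}^t\zeta_{i+1,1}\,v_{(r_n-t+i)p^n+R+1-k,\,(s_n-i)p^n+S}.\] Then $(g-1)^{(r_n+s_n-2t-1)p^n}(y_\ell)=z_\ell$.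
   Context: $p$ is a prime, $F$ a field of characteristic $p$, $G=\langle g\rangle$ a cyclic group of order $q=p^a$ ($a$ a positive integer). $V_q$ is the indecomposable $FG$-module of dimension $q$, with ordered $F$-basis $(v_1,\dots,v_q)$ such that $gv_1=v_1$ and $gv_i=v_{i-1}+v_i$ for $i>1$; $V_i=\langle v_1,\dots,v_i\rangle$, and $V_1,\dots,V_q$ is a complete set of indecomposable $FG$-modules. Let $1\le r,s\le q$ and write $V_r\otimes V_s\cong V_{\lambda_1}\oplus\dots\oplus V_{\lambda_{\min(r,s)}}$ with $\lambda_1\ge\dots\ge\lambda_{\min(r,s)}>0$. Let $n$ be the unique nonnegative integer with $p^n\le\max(r,s)<p^{n+1}$, and write $r=r_np^n+R$, $s=s_np^n+S$ with integers $0\le r_n,s_n<p$ and $0\le R,S<p^n$ (the paper writes $R_{n-1},S_{n-1}$). The elements $v_{i,j}=v_i\otimes g^{n-i}v_j$ ($1\le i\le r$, $1\le j\le s$) form a basis of $V_r\otimes V_s$ satisfying $(g-1)v_{i,j}=v_{i-1,j}+v_{i,j-1}$, with $v_{i,j}=0$ if $i\le0$ or $j\le0$. Put $D_d=\langle v_{i,j}\mid i+j=d+1\rangle$ for $1\le d\le r+s-1$ and $x_d=\sum_{i=1}^d(-1)^{i-1}v_{i,d+1-i}$ for $1\le d\le\min(r,s)$. Binomial coefficients $\binom cd$ are $0$ if $d<0$ or $d>c$, and are regarded as elements of $F$. *)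

theory Defs
  imports
    "HOL-Algebra.Generated_Groups"
    "HOL-Library.Function_Algebras"
    "HOL-Computational_Algebra.Computational_Algebra"
    "Jordan_Normal_Form.Gauss_Jordan_Elimination"
begin

section \<open>Vector spaces of functions\<close>

definition fscale :: "'f::field \<Rightarrow> ('i \<Rightarrow> 'f) \<Rightarrow> 'i \<Rightarrow> 'f" where
  "fscale c x = (\<lambda>i. c * x i)"

interpretation fun_space: vector_space "fscale :: 'f::field \<Rightarrow> ('i \<Rightarrow> 'f) \<Rightarrow> 'i \<Rightarrow> 'f"
  by unfold_locales (auto simp: fscale_def fun_eq_iff algebra_simps)

definition linear_on :: "('i \<Rightarrow> 'f::field) set \<Rightarrow> (('i \<Rightarrow> 'f) \<Rightarrow> 'j \<Rightarrow> 'f) \<Rightarrow> bool" where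
  "linear_on V f \<longleftrightarrow>
     (\<forall>x\<in>V. \<forall>y\<in>V. f (x + y) = f x + f y) \<and>
     (\<forall>c. \<forall>x\<in>V. f (fscale c x) = fscale c (f x))"

section \<open>Modules over the group algebra\<close>

text \<open>
  A module over the group algebra of \<open>G\<close> over the field \<open>'f\<close> is given by a subspace \<open>V\<close> and
  a linear action of \<open>G\<close> on \<open>V\<close>; the values of \<open>act\<close> off \<open>V\<close> are irrelevant.
\<close>

definition FG_module ::
    "('g, 'm) monoid_scheme \<Rightarrow> ('i \<Rightarrow> 'f::field) set \<Rightarrow> ('g \<Rightarrow> ('i \<Rightarrow> 'f) \<Rightarrow> 'i \<Rightarrow> 'f) \<Rightarrow> bool" where
  "FG_module G V act \<longleftrightarrow>
     fun_space.subspace V \<and>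
     (\<forall>h\<in>carrier G. act h ` V \<subseteq> V \<and> linear_on V (act h)) \<and>
     (\<forall>x\<in>V. act \<one>\<^bsub>G\<^esub> x = x) \<and>
     (\<forall>h\<in>carrier G. \<forall>k\<in>carrier G. \<forall>x\<in>V. act (h \<otimes>\<^bsub>G\<^esub> k) x = act h (act k x))"

definition FG_isomorphic ::
    "('g, 'm) monoid_scheme \<Rightarrow>
     ('i \<Rightarrow> 'f::field) set \<Rightarrow> ('g \<Rightarrow> ('i \<Rightarrow> 'f) \<Rightarrow> 'i \<Rightarrow> 'f) \<Rightarrow>
     ('j \<Rightarrow> 'f) set \<Rightarrow> ('g \<Rightarrow> ('j \<Rightarrow> 'f) \<Rightarrow> 'j \<Rightarrow> 'f) \<Rightarrow> bool" where
  "FG_isomorphic G V actV W actW \<longleftrightarrow>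
     (\<exists>\<phi>. bij_betw \<phi> V W \<and> linear_on V \<phi> \<and>
          (\<forall>h\<in>carrier G. \<forall>x\<in>V. \<phi> (actV h x) = actW h (\<phi> x)))"

section \<open>The modules \<open>V\<^sub>m\<close>, their tensor products and direct sums\<close>

text \<open>Basis vectors are numbered from 1; \<open>bvec 0 = 0\<close>.\<close>

definition bvec :: "nat \<Rightarrow> nat \<Rightarrow> 'f::field" where
  "bvec i = (\<lambda>k. if 1 \<le> i \<and> k = i then 1 else 0)"

definition Vsp :: "nat \<Rightarrow> (nat \<Rightarrow> 'f::field) set" where
  "Vsp m = fun_space.span {bvec i | i. 1 \<le> i \<and> i \<le> m}"

text \<open>
  The tensor product of two spaces of functions on \<open>nat\<close>, realised inside the functions on
  \<open>nat \<times> nat\<close> (over a field, the canonical map from the tensor product to the latter is injective).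
\<close>

definition tensor :: "(nat \<Rightarrow> 'f::field) \<Rightarrow> (nat \<Rightarrow> 'f) \<Rightarrow> nat \<times> nat \<Rightarrow> 'f" where
  "tensor x y = (\<lambda>(i, j). x i * y j)"

definition Tsp :: "nat \<Rightarrow> nat \<Rightarrow> (nat \<times> nat \<Rightarrow> 'f::field) set" where
  "Tsp r s = fun_space.span {tensor x y | x y. x \<in> Vsp r \<and> y \<in> Vsp s}"

text \<open>
  The diagonal action: the linear map on \<open>Tsp r s\<close> that sends \<open>tensor x y\<close> to
  \<open>tensor (act h x) (act h y)\<close>, see \<open>Tact_tensor\<close> below.
\<close>

definition Tact ::
    "nat \<Rightarrow> nat \<Rightarrow> ('g \<Rightarrow> (nat \<Rightarrow> 'f::field) \<Rightarrow> nat \<Rightarrow> 'f) \<Rightarrow> 'g \<Rightarrow> (nat \<times> nat \<Rightarrow> 'f) \<Rightarrow> nat \<times> nat \<Rightarrow> 'f"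
  where
  "Tact r s act h w =
     (\<Sum>i = 1..r. \<Sum>j = 1..s. fscale (w (i, j)) (tensor (act h (bvec i)) (act h (bvec j))))"

text \<open>
  The direct sum of \<open>V\<^bsub>lam 1\<^esub>, \<dots>, V\<^bsub>lam m\<^esub>\<close>: the function \<open>\<lambda>k. w (i, k)\<close> is the \<open>i\<close>-th component
  of \<open>w\<close>.
\<close>

definition DSsp :: "nat \<Rightarrow> (nat \<Rightarrow> nat) \<Rightarrow> (nat \<times> nat \<Rightarrow> 'f::field) set" where
  "DSsp m lam = {w. (\<forall>i\<in>{1..m}. (\<lambda>k. w (i, k)) \<in> Vsp (lam i)) \<and>
                    (\<forall>i k. i \<notin> {1..m} \<longrightarrow> w (i, k) = 0)}"

definition DSact ::
    "('g \<Rightarrow> (nat \<Rightarrow> 'f::field) \<Rightarrow> nat \<Rightarrow> 'f) \<Rightarrow> 'g \<Rightarrow> (nat \<times> nat \<Rightarrow> 'f) \<Rightarrow> nat \<times> nat \<Rightarrow> 'f" where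
  "DSact act h w = (\<lambda>(i, k). act h (\<lambda>k'. w (i, k')) k)"

section \<open>The vectors \<open>v\<^bsub>i,j\<^esub>\<close>, the spaces \<open>D\<^sub>d\<close> and the vectors \<open>x\<^sub>d\<close>\<close>

text \<open>The exponent \<open>n - i\<close> is an integer, possibly negative.\<close>

definition vij ::
    "('g, 'm) monoid_scheme \<Rightarrow> 'g \<Rightarrow> ('g \<Rightarrow> (nat \<Rightarrow> 'f::field) \<Rightarrow> nat \<Rightarrow> 'f) \<Rightarrow> nat \<Rightarrow>
     nat \<Rightarrow> nat \<Rightarrow> nat \<times> nat \<Rightarrow> 'f" where
  "vij G g act n i j = tensor (bvec i) (act (g [^]\<^bsub>G\<^esub> (int n - int i)) (bvec j))"

definition Dsp :: "(nat \<Rightarrow> nat \<Rightarrow> nat \<times> nat \<Rightarrow> 'f::field) \<Rightarrow> nat \<Rightarrow> nat \<Rightarrow> nat \<Rightarrow> (nat \<times> nat \<Rightarrow> 'f) set"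
  where
  "Dsp v r s d =
     fun_space.span {v i j | i j. 1 \<le> i \<and> i \<le> r \<and> 1 \<le> j \<and> j \<le> s \<and> i + j = d + 1}"

definition xvec :: "(nat \<Rightarrow> nat \<Rightarrow> nat \<times> nat \<Rightarrow> 'f::field) \<Rightarrow> nat \<Rightarrow> nat \<times> nat \<Rightarrow> 'f" where
  "xvec v d = (\<Sum>i = 1..d. fscale ((- 1) ^ (i - 1)) (v i (d + 1 - i)))"

definition binom :: "int \<Rightarrow> int \<Rightarrow> 'f::field" where
  "binom c d = (if d < 0 \<or> d > c then 0 else of_nat (nat c choose nat d))"

section \<open>The diagonal action on pure tensors\<close>

lemma linear_on_sum:
  assumes f: "linear_on V f" and V: "fun_space.subspace V"
    and "finite I" and x: "\<And>i. i \<in> I \<Longrightarrow> x i \<in> V"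
  shows "f (\<Sum>i\<in>I. fscale (c i) (x i)) = (\<Sum>i\<in>I. fscale (c i) (f (x i)))"
  using \<open>finite I\<close> x
proof (induction I rule: finite_induct)
  case empty
  have "f (fscale 0 0) = fscale 0 (f 0)"
    using f fun_space.subspace_0[OF V] unfolding linear_on_def by blast
  then show ?case by (simp add: fscale_def zero_fun_def)
next
  case (insert a I)
  have "(\<Sum>i\<in>I. fscale (c i) (x i)) \<in> V" "fscale (c a) (x a) \<in> V"
    using insert by (auto intro!: fun_space.subspace_sum fun_space.subspace_scale V)
  then have "f (fscale (c a) (x a) + (\<Sum>i\<in>I. fscale (c i) (x i)))
      = fscale (c a) (f (x a)) + (\<Sum>i\<in>I. fscale (c i) (f (x i)))"
    using insert f by (simp add: linear_on_def del: plus_fun_apply)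
  then show ?case
    using insert.hyps by (simp only: sum.insert not_False_eq_True)
qed

lemma sum_fun_apply: "(\<Sum>i\<in>I. f i) k = (\<Sum>i\<in>I. f i k)"
  by (induction I rule: infinite_finite_induct) auto

lemma Vsp_expand:
  assumes "x \<in> Vsp m"
  shows "x = (\<Sum>i = 1..m. fscale (x i) (bvec i))"
proof -
  have sup: "x i = 0" if "i \<notin> {1..m}" for i
    using assms[unfolded Vsp_def] that
    by (induction rule: fun_space.span_induct_alt) (auto simp: bvec_def fscale_def)
  show ?thesis
  proof
    fix k
    have "(\<Sum>i = 1..m. fscale (x i) (bvec i)) k = (\<Sum>i = 1..m. if i = k then x i else 0)"
      unfolding sum_fun_apply by (rule sum.cong) (auto simp: fscale_def bvec_def)
    then show "x k = (\<Sum>i = 1..m. fscale (x i) (bvec i)) k"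
      using sup by (auto simp: sum.delta)
  qed
qed

lemma Tact_tensor:
  fixes act :: "'g \<Rightarrow> (nat \<Rightarrow> 'f::field) \<Rightarrow> nat \<Rightarrow> 'f"
  assumes f: "linear_on (Vsp q) (act h)" and "r \<le> q" "s \<le> q" and x: "x \<in> Vsp r" and y: "y \<in> Vsp s"
  shows "Tact r s act h (tensor x y) = tensor (act h x) (act h y)"
proof -
  have V: "fun_space.subspace (Vsp q)"
    by (simp add: Vsp_def)
  have b: "(bvec i :: nat \<Rightarrow> 'f) \<in> Vsp q" if "i \<in> {1..q}" for i
    using that by (auto simp: Vsp_def intro: fun_space.span_base)
  have X: "act h x = (\<Sum>i = 1..r. fscale (x i) (act h (bvec i)))"
    by (subst Vsp_expand[OF x], rule linear_on_sum[OF f V]) (use b \<open>r \<le> q\<close> in auto)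
  have Y: "act h y = (\<Sum>j = 1..s. fscale (y j) (act h (bvec j)))"
    by (subst Vsp_expand[OF y], rule linear_on_sum[OF f V]) (use b \<open>s \<le> q\<close> in auto)
  show ?thesis
    unfolding X Y
    by (auto simp: fun_eq_iff Tact_def tensor_def sum_fun_apply fscale_def sum_product
        intro!: sum.cong)
qed

end

theory Submission
  imports Defs "Jordan_Normal_Form.Determinant"
begin

text \<open>
  Sending \<open>v\<^bsub>i,j\<^esub>\<close> to \<open>X\<^bsup>r-i\<^esup>Y\<^bsup>s-j\<^esup>\<close> identifies the tensor product with \<open>F[X,Y]/(X\<^sup>r, Y\<^sup>s)\<close> and
  \<open>\<Delta> = g - 1\<close> with multiplication by \<open>X + Y\<close>; a form of degree \<open>h\<close> is stored as a polynomial in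
  \<open>X\<close>, and \<open>D\<^sub>d\<close> is the part of degree \<open>r + s - 1 - d\<close>. Since \<open>(X + Y)\<^bsup>mp^n\<^esup> = (X\<^bsup>p^n\<^esup> + Y\<^bsup>p^n\<^esup>)\<^sup>m\<close>,
  the equations for \<open>y\<close> and \<open>z\<close> reduce to \<open>P \<zeta> = X\<close>. The matrix \<open>P\<close> is invertible because a nonzero
  polynomial of degree less than \<open>p\<close> that is divisible by \<open>(1 + x)\<^sup>m\<close> has more than \<open>m\<close> nonzero
  coefficients.

  For \<open>\<lambda>\<^sub>l\<close> the single vector \<open>y\<close> with \<open>k = R + 1\<close> suffices. Let \<open>N = (r\<^sub>n + s\<^sub>n - 2t)p\<^sup>n\<close>. Multiplying
  \<open>y\<close> by powers of \<open>Y\<close> shows that \<open>\<Delta>\<^bsup>N-1\<^esup>\<close> hits \<open>x\<^sub>d\<close> for all \<open>d \<le> tp\<^sup>n + S\<close>, whence at least \<open>tp\<^sup>n + S\<close>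
  summands have dimension at least \<open>N\<close>. The same multiples lie in the kernel of \<open>\<Delta>\<^sup>N\<close>, and they are
  not divisible by \<open>X + Y\<close>, so modulo this kernel and the image of \<open>\<Delta>\<close> the whole space is spanned
  by \<open>tp\<^sup>n + R\<close> vectors, whence at most that many summands have dimension greater than \<open>N\<close>.
\<close>

section \<open>Sparse polynomials divisible by a power of \<open>1 + x\<close>\<close>

lemma coeff_one_plus_mult:
  "coeff ([:1, 1:] * f) k = coeff f k + (if k = 0 then 0 else coeff f (k - 1))"
  for f :: "'a::comm_ring_1 poly"
  by (cases k) auto

text \<open>Induction on \<open>m\<close>: passing to \<open>x f' - c f\<close> removes the exponent
  \<open>c\<close> and costs at most one factor \<open>1 + x\<close>, so the result is zero by
  induction. Then \<open>f\<close> is a multiple of \<open>x^c\<close>, and this vanishes at -1 only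
  if it is zero.\<close>

lemma sparse_multiple_eq_0:
  fixes f :: "'a::field poly"
  assumes "degree f < CHAR('a)" and "[:1, 1:] ^ m dvd f" and "card {k. coeff f k \<noteq> 0} \<le> m"
  shows "f = 0"
  using assms
proof (induction m arbitrary: f)
  case 0
  have "finite {k. coeff f k \<noteq> 0}"
    by (rule finite_subset[of _ "{..degree f}"]) (auto simp: le_degree)
  then show ?case
    using 0 by (auto simp: poly_eq_iff)
next
  case (Suc m)
  show ?case
  proof (rule ccontr)
    assume "f \<noteq> 0"
    then obtain c where c: "coeff f c \<noteq> 0"
      by (auto simp: poly_eq_iff)
    \<comment> \<open>\<open>x f' - c f\<close> loses the exponent \<open>c\<close> and keeps all others, the degree being less than \<open>p\<close>.\<close>
    define g where "g = [:0, 1:] * pderiv f - Polynomial.smult (of_nat c) f"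
    have coeff_g: "coeff g k = (of_nat k - of_nat c) * coeff f k" for k
      by (cases k) (auto simp: g_def coeff_pderiv algebra_simps)
    have fin: "finite {k. coeff f k \<noteq> 0}"
      by (rule finite_subset[of _ "{..degree f}"]) (auto simp: le_degree)
    have "{k. coeff g k \<noteq> 0} \<subseteq> {k. coeff f k \<noteq> 0} - {c}"
      by (auto simp: coeff_g)
    then have "card {k. coeff g k \<noteq> 0} \<le> card ({k. coeff f k \<noteq> 0} - {c})"
      by (intro card_mono) (use fin in auto)
    also have "\<dots> \<le> m"
      using Suc.prems(3) c fin by simp
    finally have "card {k. coeff g k \<noteq> 0} \<le> m" .
    moreover have "degree g \<le> degree f"
      by (rule degree_le) (auto simp: coeff_g coeff_eq_0)
    then have "degree g < CHAR('a)"
      using Suc.prems(1) by simp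
    moreover have "[:1, 1:] ^ m dvd g"
    proof -
      obtain h where h: "f = [:1, 1:] ^ Suc m * h"
        using Suc.prems(2) by (elim dvdE)
      have "pderiv f = [:1, 1:] ^ m * ([:1, 1:] * pderiv h + Polynomial.smult (of_nat (Suc m)) h)"
        unfolding h pderiv_mult pderiv_power_Suc
        by (simp add: pderiv_pCons algebra_simps)
      moreover have "[:1, 1:] ^ m dvd f"
        using Suc.prems(2) by (meson dvd_trans le_imp_power_dvd le_SucI order_refl)
      ultimately show ?thesis
        unfolding g_def by (metis dvd_diff dvd_mult dvd_smult dvd_triv_left)
    qed
    ultimately have "g = 0"
      using Suc.IH by blast
    \<comment> \<open>Distinct exponents below the characteristic stay distinct modulo it, so the
      factor \<open>k - c\<close> is nonzero in the field.\<close>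
    have "coeff f k = 0" if "k \<noteq> c" for k
    proof (rule ccontr)
      assume k: "coeff f k \<noteq> 0"
      then have eq: "(of_nat k :: 'a) = of_nat c"
        using coeff_g[of k] \<open>g = 0\<close> by simp
      have "k < CHAR('a)" "c < CHAR('a)"
        using k c Suc.prems(1) by (meson le_degree le_less_trans)+
      moreover have "CHAR('a) dvd k - c" if "c \<le> k"
        using eq that by (simp flip: of_nat_eq_0_iff_char_dvd)
      moreover have "CHAR('a) dvd c - k" if "k \<le> c"
        using eq that by (simp flip: of_nat_eq_0_iff_char_dvd)
      ultimately show False
        using that by (metis diff_is_0_eq dvd_imp_le le_antisym less_imp_diff_less nat_le_linear not_gr_zero not_le)
    qed
    then have "f = monom (coeff f c) c"
      by (auto simp: poly_eq_iff)
    moreover have "poly f (- 1) = 0"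
      using Suc.prems(2) by (auto elim!: dvdE)
    ultimately have "coeff f c * (- 1) ^ c = 0"
      by (metis poly_monom)
    with c show False by simp
  qed
qed

lemma coeff_one_plus_power:
  "coeff ([:1, 1:] ^ m :: 'a::field poly) k = of_nat (m choose k)"
  by (cases "k \<le> m") (simp_all add: coeff_linear_poly_power coeff_eq_0 degree_power_eq binomial_eq_0)

text \<open>The reversed exponents \<open>t - j\<close> turn multiplication by
  \<open>(1 + x)^m\<close> into a Toeplitz matrix acting on \<open>\<zeta>\<close>: the difference
  of the exponents is \<open>c + j - i\<close>.\<close>

lemma coeff_one_plus_power_mult_sum:
  fixes \<zeta> :: "nat \<Rightarrow> 'a::field"
  assumes "i \<le> t"
  shows "coeff ([:1, 1:] ^ m * (\<Sum>j = 0..t. monom (\<zeta> j) (t - j))) (c + t - i)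
    = (\<Sum>j = 0..t. binom (int m) (int c + int j - int i) * \<zeta> j)"
  unfolding sum_distrib_left coeff_sum
proof (rule sum.cong)
  fix j assume j: "j \<in> {0..t}"
  have [simp]: "nat (int c + int j - int i) = c + j - i"
    by linarith
  have "coeff ([:1, 1:] ^ m * monom (\<zeta> j) (t - j)) (c + t - i)
      = (if c + t - i < t - j then 0 else \<zeta> j * of_nat (m choose (c + t - i - (t - j))))"
    by (subst mult.commute) (simp add: coeff_monom_mult coeff_one_plus_power)
  also have "\<dots> = binom (int m) (int c + int j - int i) * \<zeta> j"
    using j assms by (auto simp: binom_def binomial_eq_0)
  finally show "coeff ([:1, 1:] ^ m * monom (\<zeta> j) (t - j)) (c + t - i)
      = binom (int m) (int c + int j - int i) * \<zeta> j" .
qed simp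

lemma coeff_one_plus_power_mult_beyond:
  fixes f :: "'a::field poly"
  assumes "degree f \<le> t" and "m + t < k"
  shows "coeff ([:1, 1:] ^ m * f) k = 0"
proof (rule coeff_eq_0)
  have "degree ([:1, 1:] ^ m * f) \<le> degree ([:1, 1:] ^ m :: 'a poly) + degree f"
    by (rule degree_mult_le)
  also have "degree ([:1, 1:] ^ m :: 'a poly) = m"
    by (simp add: degree_power_eq)
  finally show "degree ([:1, 1:] ^ m * f) < k"
    using assms by simp
qed

text \<open>The product has at most \<open>m + t + 1\<close> coefficients and the gap removes
  \<open>c' - c\<close> of them. At most \<open>e\<close> remain, too few for a nonzero multiple of
  \<open>(1 + x)^e\<close>. The exponent \<open>e\<close> may exceed \<open>m\<close>, since
  \<open>f\<close> can contribute factors \<open>1 + x\<close> itself.\<close>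

lemma one_plus_power_mult_gap_eq_0:
  fixes f :: "'a::field poly"
  assumes deg: "degree f \<le> t" and mt: "m + t < CHAR('a)" and "c \<le> c'" "c' \<le> Suc (m + t)"
    and gap: "\<And>k. c \<le> k \<Longrightarrow> k < c' \<Longrightarrow> coeff ([:1, 1:] ^ m * f) k = 0"
    and dvd: "[:1, 1:] ^ e dvd [:1, 1:] ^ m * f" and e: "c + Suc (m + t) \<le> c' + e"
  shows "f = 0"
proof -
  let ?g = "[:1, 1:] ^ m * f"
  have beyond: "coeff ?g k = 0" if "m + t < k" for k
    using coeff_one_plus_power_mult_beyond[OF deg that] .
  have "{k. coeff ?g k \<noteq> 0} \<subseteq> {..<c} \<union> {c'..<Suc (m + t)}"
    using gap beyond by (auto simp: not_less) (metis not_less not_less_eq)+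
  then have "card {k. coeff ?g k \<noteq> 0} \<le> card ({..<c} \<union> {c'..<Suc (m + t)})"
    by (rule card_mono[rotated]) simp
  also have "\<dots> \<le> c + (Suc (m + t) - c')"
    using card_Un_le[of "{..<c}" "{c'..<Suc (m + t)}"] by simp
  also have "\<dots> \<le> e"
    using e assms(3,4) by linarith
  finally have "card {k. coeff ?g k \<noteq> 0} \<le> e" .
  moreover have "degree ?g \<le> m + t"
    by (rule degree_le) (use beyond in auto)
  ultimately have "?g = 0"
    using sparse_multiple_eq_0[of ?g e] dvd mt by auto
  then show "f = 0" by simp
qed

lemma degree_sum_monom_le:
  "degree (\<Sum>j = 0..t. monom (\<zeta> j) (t - j)) \<le> t"
  by (intro degree_sum_le) (auto intro: order.trans[OF degree_monom_le])

lemma coeff_sum_monom: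
  fixes \<zeta> :: "nat \<Rightarrow> 'a::field"
  assumes "i \<le> t"
  shows "coeff (\<Sum>j = 0..t. monom (\<zeta> j) (t - j)) (t - i) = \<zeta> i"
proof -
  have "coeff (\<Sum>j = 0..t. monom (\<zeta> j) (t - j)) (t - i) = (\<Sum>j = 0..t. if j = i then \<zeta> j else 0)"
    unfolding coeff_sum by (rule sum.cong) (use assms in auto)
  then show ?thesis using assms by simp
qed

section \<open>Substitution of \<open>x^P\<close> and the Frobenius map\<close>

lemma pcompose_power: "pcompose (f ^ k) g = pcompose f g ^ k" for f g :: "'a::comm_ring_1 poly"
  by (induction k) (simp_all add: pcompose_1 pcompose_mult)

lemma pcompose_monom:
  "pcompose (monom c k) (monom 1 P) = monom c (P * k)" for c :: "'a::comm_ring_1"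
  by (simp add: monom_altdef pcompose_smult pcompose_power pcompose_pCons flip: power_mult)

lemma coeff_pcompose_monom:
  fixes f :: "'a::comm_ring_1 poly"
  assumes "P > 0"
  shows "coeff (pcompose f (monom 1 P)) k = (if P dvd k then coeff f (k div P) else 0)"
proof -
  have "pcompose f (monom 1 P) = (\<Sum>i\<le>degree f. monom (coeff f i) (P * i))"
    by (subst poly_as_sum_of_monoms[of f, symmetric]) (simp only: pcompose_sum pcompose_monom)
  then have "coeff (pcompose f (monom 1 P)) k = (\<Sum>i\<le>degree f. if P * i = k then coeff f i else 0)"
    by (simp add: coeff_sum)
  also have "\<dots> = (if P dvd k then coeff f (k div P) else 0)"
  proof (cases "P dvd k")
    case True
    then obtain l where l: "k = P * l" by (elim dvdE)
    have "(\<Sum>i\<le>degree f. if P * i = k then coeff f i else 0) = (\<Sum>i\<le>degree f. if i = l then coeff f i else 0)"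
      by (rule sum.cong) (use l assms in auto)
    then show ?thesis using l assms by (auto simp: coeff_eq_0)
  next
    case False
    then show ?thesis by (auto intro!: sum.neutral)
  qed
  finally show ?thesis .
qed

lemma one_plus_power_CHAR:
  assumes "prime CHAR('a::field)" "P = CHAR('a) ^ n"
  shows "[:1, 1:] ^ P = (1 + monom 1 P :: 'a poly)"
proof -
  have "[:1, 1:] = (1 + monom 1 1 :: 'a poly)"
    by (simp add: monom_altdef one_pCons)
  then have "[:1, 1:] ^ P = (1 + monom 1 1 :: 'a poly) ^ P" by simp
  also have "\<dots> = 1 ^ P + monom 1 1 ^ P"
    by (rule freshmans_dream') (use assms in auto)
  finally show ?thesis by (simp add: monom_power)
qed

text \<open>Additivity of the Frobenius power at \<open>1 + (-1) = 0\<close>, which covers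
  characteristic 2 without a case distinction.\<close>

lemma minus_one_power_CHAR:
  assumes "prime CHAR('a::field)" "P = CHAR('a) ^ n"
  shows "(- 1 :: 'a) ^ P = - 1"
proof -
  have "(1 + - 1 :: 'a) ^ P = 1 ^ P + (- 1) ^ P"
    by (rule freshmans_dream') (use assms in auto)
  moreover have "P > 0"
    using assms by (auto simp: prime_gt_0_nat)
  ultimately have "1 + (- 1 :: 'a) ^ P = 0"
    by (simp add: power_0_left)
  then show ?thesis
    by (simp add: add_eq_0_iff)
qed

text \<open>Since \<open>(1 + x)^P = 1 + x^P\<close>, the factor \<open>(1 + x)^(mP)\<close> acts on
  polynomials in \<open>x^P\<close> as \<open>(1 + x)^m\<close> does on polynomials in
  \<open>x\<close>.\<close>

lemma one_plus_power_mult_pcompose: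
  assumes "prime CHAR('a::field)" "P = CHAR('a) ^ n"
  shows "[:1, 1:] ^ (m * P) * pcompose f (monom 1 P) = pcompose ([:1, 1:] ^ m * f :: 'a poly) (monom 1 P)"
proof -
  have "[:1, 1 :: 'a:] ^ (m * P) = ([:1, 1:] ^ P) ^ m"
    by (simp add: mult.commute power_mult)
  moreover have "pcompose [:1, 1:] (monom 1 P) = [:1, 1 :: 'a:] ^ P"
    by (simp add: one_plus_power_CHAR[OF assms] pcompose_pCons one_pCons)
  ultimately show ?thesis
    by (simp add: pcompose_mult pcompose_power)
qed

section \<open>Toeplitz matrices of binomial coefficients\<close>

text \<open>A kernel vector, read as a polynomial \<open>f\<close> of degree at most
  \<open>t\<close>, makes \<open>t + 1\<close> consecutive coefficients of
  \<open>(1 + x)^m f\<close> vanish. At most \<open>m\<close> are left, so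
  \<open>f = 0\<close>.\<close>

lemma det_binom_toeplitz_neq_0:
  assumes c: "c \<le> m" and mt: "m + t < CHAR('a::field)"
  shows "det (mat (t + 1) (t + 1) (\<lambda>(i, j). binom (int m) (int c + int j - int i)) :: 'a mat) \<noteq> 0"
    (is "det ?P \<noteq> 0")
proof
  assume "det ?P = 0"
  then obtain u where u: "u \<in> carrier_vec (t + 1)" "u \<noteq> 0\<^sub>v (t + 1)" "?P *\<^sub>v u = 0\<^sub>v (t + 1)"
    using det_0_iff_vec_prod_zero_field[of ?P "t + 1"] by auto
  define f where "f = (\<Sum>j = 0..t. monom (u $ j) (t - j))"
  have zero: "coeff ([:1, 1:] ^ m * f) (c + t - i) = 0" if "i \<le> t" for i
  proof -
    have "coeff ([:1, 1:] ^ m * f) (c + t - i)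
        = (\<Sum>j = 0..t. binom (int m) (int c + int j - int i) * u $ j)"
      unfolding f_def by (rule coeff_one_plus_power_mult_sum) (rule that)
    also have "\<dots> = (?P *\<^sub>v u) $ i"
      using that u(1) by (auto simp: scalar_prod_def atLeastLessThanSuc_atLeastAtMost)
    also have "\<dots> = 0"
      unfolding u(3) using that by simp
    finally show ?thesis .
  qed
  have "f = 0"
  proof (rule one_plus_power_mult_gap_eq_0)
    show "degree f \<le> t"
      unfolding f_def by (rule degree_sum_monom_le)
    show "coeff ([:1, 1:] ^ m * f) k = 0" if "c \<le> k" "k < Suc (c + t)" for k
      using zero[of "c + t - k"] that by simp
    show "[:1, 1:] ^ m dvd [:1, 1:] ^ m * f"
      by simp
  qed (use assms in auto)
  then have "u $ i = 0" if "i \<le> t" for i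
    using coeff_sum_monom[OF that, of "($) u"] by (simp add: f_def)
  then have "u = 0\<^sub>v (t + 1)"
    using u(1) by (intro eq_vecI) auto
  with u(2) show False by simp
qed

text \<open>One more factor \<open>1 + x\<close> cancels neighbouring alternating coefficients, so
  \<open>(1 + x)^(m+1) f\<close> has a gap of length \<open>t\<close>. If \<open>f(-1) = 0\<close>,
  it is divisible by \<open>(1 + x)^(m+2)\<close>, and the sparsity bound gives
  \<open>f = 0\<close>.\<close>

lemma poly_toeplitz_solution_neq_0:
  fixes f :: "'a::field poly"
  assumes c: "c \<le> m" and mt: "m + t + 1 < CHAR('a)" and deg: "degree f \<le> t"
    and coeff_f: "\<And>i. i \<le> t \<Longrightarrow> coeff ([:1, 1:] ^ m * f) (c + t - i) = (- 1) ^ i"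
  shows "poly f (- 1) \<noteq> 0"
proof
  assume "poly f (- 1) = 0"
  then have "[:1, 1:] dvd f"
    by (simp add: poly_eq_0_iff_dvd)
  have "f = 0"
  proof (rule one_plus_power_mult_gap_eq_0
      [where m = "Suc m" and c = "Suc c" and c' = "Suc (c + t)" and t = t and e = "m + 2"])
    have "[:1, 1:] ^ (Suc m + 1) dvd [:1, 1:] ^ Suc m * f"
      unfolding power_add power_one_right by (rule mult_dvd_mono) (use \<open>[:1, 1:] dvd f\<close> in auto)
    then show "[:1, 1:] ^ (m + 2) dvd [:1, 1:] ^ Suc m * f"
      by simp
    show "coeff ([:1, 1:] ^ Suc m * f) k = 0" if "Suc c \<le> k" "k < Suc (c + t)" for k
    proof -
      have "coeff ([:1, 1:] ^ Suc m * f) k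
          = coeff ([:1, 1:] ^ m * f) k + coeff ([:1, 1:] ^ m * f) (k - 1)"
        using that by (simp only: power_Suc mult.assoc coeff_one_plus_mult) auto
      also have "\<dots> = (- 1) ^ (c + t - k) + (- 1) ^ Suc (c + t - k)"
        using coeff_f[of "c + t - k"] coeff_f[of "Suc (c + t - k)"] that by simp
      finally show ?thesis by simp
    qed
  qed (use assms in auto)
  with coeff_f[of 0] show False by simp
qed

section \<open>Invertible and underdetermined linear systems\<close>

lemma mat_inverse_solution:
  fixes P X :: "'a::field mat"
  assumes P: "P \<in> carrier_mat k k" and X: "X \<in> carrier_mat k 1" and "det P \<noteq> 0"
  shows "invertible_mat P" and "P * (the (mat_inverse P) * X) = X"
    and "the (mat_inverse P) * X \<in> carrier_mat k 1"
proof -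
  have "P \<in> Units (ring_mat TYPE('a) k ())"
    using det_non_zero_imp_unit[OF P \<open>det P \<noteq> 0\<close>] .
  then obtain B where B: "mat_inverse P = Some B"
    using mat_inverse(1)[OF P, of "()"] by (cases "mat_inverse P") auto
  then have inv: "P * B = 1\<^sub>m k" "B * P = 1\<^sub>m k" "B \<in> carrier_mat k k"
    using mat_inverse(2)[OF P] by auto
  show "invertible_mat P"
    unfolding invertible_mat_def inverts_mat_def using inv P by (auto simp: square_mat.simps)
  show "P * (the (mat_inverse P) * X) = X"
    using B inv P X by (simp add: assoc_mult_mat[of P k k B k X 1, symmetric])
  show "the (mat_inverse P) * X \<in> carrier_mat k 1"
    using B inv X by auto
qed

lemma homogeneous_system_nontrivial:
  fixes A :: "nat \<Rightarrow> nat \<Rightarrow> 'a::field"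
  assumes "m < k"
  obtains c where "\<exists>j<k. c j \<noteq> 0" and "\<And>i. i < m \<Longrightarrow> (\<Sum>j<k. c j * A i j) = 0"
proof -
  \<comment> \<open>Padding with zero rows makes the system square and singular.\<close>
  define M where "M = mat k k (\<lambda>(i, j). if i < m then A i j else 0)"
  have M: "M \<in> carrier_mat k k" by (simp add: M_def)
  have "M = mat\<^sub>r k k (\<lambda>i. if i = m then 0\<^sub>v k else row M i)"
    using assms by (intro eq_matI) (auto simp: M_def)
  moreover have "det (mat\<^sub>r k k (\<lambda>i. if i = m then 0\<^sub>v k else row M i)) = 0"
    by (rule det_row_0) (use assms M in auto)
  ultimately have "det M = 0" by simp
  then obtain u where u: "u \<in> carrier_vec k" "u \<noteq> 0\<^sub>v k" "M *\<^sub>v u = 0\<^sub>v k"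
    using det_0_iff_vec_prod_zero_field[OF M] by auto
  have "\<exists>j<k. u $ j \<noteq> 0"
  proof (rule ccontr)
    assume "\<not> ?thesis"
    then have "u = 0\<^sub>v k" using u(1) by (intro eq_vecI) auto
    with u(2) show False by simp
  qed
  moreover have "(\<Sum>j<k. u $ j * A i j) = 0" if "i < m" for i
  proof -
    have "(\<Sum>j<k. u $ j * A i j) = (M *\<^sub>v u) $ i"
      using that assms u(1)
      by (auto simp: M_def scalar_prod_def lessThan_atLeast0 mult.commute intro!: sum.cong)
    also have "\<dots> = 0"
      unfolding u(3) using that assms by simp
    finally show ?thesis .
  qed
  ultimately show ?thesis using that by blast
qed

section \<open>Forms in two variables modulo \<open>(X\<^sup>r, Y\<^sup>s)\<close>\<close>

text \<open>The homogeneous form \<open>\<Sum>k\<le>h. coeff f k X\<^sup>k Y\<^bsup>h-k\<^esup>\<close> of degree \<open>h\<close>, modulo the ideal \<open>(X\<^sup>r, Y\<^sup>s)\<close>,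
  depends only on these coefficients of \<open>f\<close>.\<close>

definition form_eq :: "nat \<Rightarrow> nat \<Rightarrow> nat \<Rightarrow> 'a::zero poly \<Rightarrow> 'a poly \<Rightarrow> bool" where
  "form_eq r s h f g \<longleftrightarrow> (\<forall>k<r. h < k + s \<longrightarrow> coeff f k = coeff g k)"

text \<open>Raising \<open>h\<close> while keeping \<open>f\<close> multiplies the form by a power
  of \<open>Y\<close>, so more monomials fall into the ideal and fewer coefficients count.\<close>

lemma form_eq_mono: "form_eq r s h f g \<Longrightarrow> h \<le> h' \<Longrightarrow> form_eq r s h' f g"
  by (auto simp: form_eq_def)

lemma form_eq_one_plus_power:
  fixes f g :: "'a::comm_ring_1 poly"
  assumes "form_eq r s h f g"
  shows "form_eq r s (h + e) ([:1, 1:] ^ e * f) ([:1, 1:] ^ e * g)"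
proof (induction e)
  case (Suc e)
  then have IH: "\<And>k. k < r \<Longrightarrow> h + e < k + s \<Longrightarrow> coeff ([:1, 1:] ^ e * f) k = coeff ([:1, 1:] ^ e * g) k"
    by (auto simp: form_eq_def)
  show ?case
    unfolding form_eq_def power_Suc mult.assoc coeff_one_plus_mult
    using IH by (auto intro!: arg_cong2[of _ _ _ _ "(+)"])
qed (use assms in simp)

lemma form_eq_trans: "form_eq r s h f g \<Longrightarrow> form_eq r s h g g' \<Longrightarrow> form_eq r s h f g'"
  by (auto simp: form_eq_def)

text \<open>The quotient of \<open>x^(c+t+1) + (-1)^t x^c\<close> by \<open>1 + x\<close>. Its
  coefficients are the right-hand sides of the Toeplitz system, and it leads to the polynomial of
  \<open>z\<close>.\<close>

definition alt_sum :: "nat \<Rightarrow> nat \<Rightarrow> 'a::comm_ring_1 poly" where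
  "alt_sum t c = (\<Sum>i = 0..t. monom ((- 1) ^ i) (c + t - i))"

lemma one_plus_mult_alt_sum:
  "[:1, 1:] * alt_sum t c = (monom 1 (c + t + 1) + monom ((- 1) ^ t) c :: 'a::comm_ring_1 poly)"
proof (induction t)
  case 0
  then show ?case by (simp add: alt_sum_def monom_Suc)
next
  case (Suc t)
  have "alt_sum (Suc t) c = (monom 1 (c + Suc t) - alt_sum t c :: 'a poly)"
    unfolding alt_sum_def sum.atLeast0_atMost_Suc_shift by (simp add: sum_negf flip: minus_monom)
  then have "[:1, 1:] * alt_sum (Suc t) c
      = ([:1, 1:] * monom 1 (c + Suc t) - [:1, 1:] * alt_sum t c :: 'a poly)"
    by (simp only: right_diff_distrib)
  also have "[:1, 1:] * monom 1 (c + Suc t) = (monom 1 (c + Suc t) + monom 1 (c + Suc t + 1) :: 'a poly)"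
    by (simp add: monom_Suc)
  also have "\<dots> - [:1, 1:] * alt_sum t c = monom 1 (c + Suc t + 1) + monom ((- 1) ^ Suc t) c"
    unfolding Suc.IH by (simp flip: minus_monom)
  finally show ?case .
qed

text \<open>Below the exponent \<open>b\<close>, \<open>f\<close> agrees with the power series
  \<open>\<alpha> x^a / (1 + x)\<close>.\<close>

lemma coeff_alternating:
  fixes f :: "'a::comm_ring_1 poly"
  assumes f: "[:1, 1:] * f = monom \<alpha> a + monom \<beta> b" and "k < b"
  shows "coeff f k = (if k < a then 0 else \<alpha> * (- 1) ^ (k - a))"
  using \<open>k < b\<close>
proof (induction k)
  case 0
  then show ?case
    using arg_cong[OF f, of "\<lambda>h. coeff h 0"] by auto
next
  case (Suc k)
  have "coeff ([:1, 1:] * f) (Suc k) = (if a = Suc k then \<alpha> else 0)"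
    unfolding f using Suc.prems by auto
  then have "coeff f (Suc k) = (if a = Suc k then \<alpha> else 0) - coeff f k"
    unfolding coeff_one_plus_mult by (simp add: algebra_simps)
  then show ?case
    using Suc by (auto simp: not_less Suc_diff_le)
qed

text \<open>This one polynomial represents every \<open>xvec v d\<close>; only the degree
  \<open>r + s - 1 - d\<close> of the form records \<open>d\<close>.\<close>

definition alt_poly :: "nat \<Rightarrow> 'a::comm_ring_1 poly" where
  "alt_poly r = (\<Sum>j<r. monom ((- 1) ^ (r - 1 - j)) j)"

lemma coeff_alt_poly: "coeff (alt_poly r) k = (if k < r then (- 1) ^ (r - 1 - k) else 0)"
  by (simp add: alt_poly_def coeff_sum if_distrib cong: if_cong)

lemma degree_alt_poly: "degree (alt_poly r) \<le> r - 1"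
  by (rule degree_le) (auto simp: coeff_alt_poly)

text \<open>The product telescopes to \<open>x^r\<close> and a constant. Both vanish modulo the
  ideal: \<open>X^r\<close> always, and \<open>Y^h\<close> because \<open>s \<le> h\<close>.\<close>

lemma form_eq_one_plus_mult_alt_poly:
  assumes "s \<le> h"
  shows "form_eq r s h ([:1, 1:] * alt_poly r) (0 :: 'a::comm_ring_1 poly)"
  unfolding form_eq_def coeff_one_plus_mult coeff_alt_poly
proof (intro allI impI)
  fix k assume "k < r" "h < k + s"
  then have "0 < k" "r - 1 - (k - 1) = Suc (r - 1 - k)"
    using assms by auto
  with \<open>k < r\<close> show "(if k < r then (- 1) ^ (r - 1 - k) else 0)
      + (if k = 0 then 0 else if k - 1 < r then (- 1) ^ (r - 1 - (k - 1)) else 0) = coeff (0 :: 'a poly) k"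
    by auto
qed

text \<open>Only exponents \<open>k - 1 + P j\<close> occur. The bound from \<open>r\<close>, with
  \<open>R < k\<close>, gives \<open>j \<le> c + t\<close>; the bound from \<open>s\<close>, with
  \<open>S < P\<close>, gives \<open>c \<le> j\<close>. So at most the \<open>t + 1\<close>
  coefficients prescribed by the Toeplitz system count.\<close>

lemma form_eq_toeplitz:
  fixes f :: "'a::field poly"
  assumes P: "P > 0" and "R < k" "S < P"
    and f: "\<And>i. i \<le> t \<Longrightarrow> coeff f (c + t - i) = (- 1) ^ i"
  shows "form_eq ((c + t + 1) * P + R) ((b + t) * P + S) ((c + b + t) * P + (k - 1))
    (monom 1 (k - 1) * pcompose f (monom 1 P))
    (monom 1 (k - 1) * pcompose (alt_sum t c) (monom 1 P))"
  unfolding form_eq_def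
proof (intro allI impI)
  fix l assume l: "l < (c + t + 1) * P + R" "(c + b + t) * P + (k - 1) < l + ((b + t) * P + S)"
  show "coeff (monom 1 (k - 1) * pcompose f (monom 1 P)) l
      = coeff (monom 1 (k - 1) * pcompose (alt_sum t c) (monom 1 P)) l"
  proof (cases "k - 1 \<le> l \<and> P dvd l - (k - 1)")
    case False
    then show ?thesis by (auto simp: coeff_monom_mult coeff_pcompose_monom P)
  next
    case True
    then obtain j where j: "l = k - 1 + P * j"
      by (metis dvdE le_add_diff_inverse)
    have "P * j < P * (c + t + 1)"
      using l(1) j \<open>R < k\<close> by (simp add: mult.commute)
    then have "j \<le> c + t"
      unfolding nat_mult_less_cancel1[OF P] by simp
    have "P * c < P * j + S"
      using l(2) j by (simp add: algebra_simps)
    then have "P * c < P * Suc j"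
      using \<open>S < P\<close> by simp
    then have "c \<le> j"
      unfolding nat_mult_less_cancel1[OF P] by simp
    define i where "i = c + t - j"
    have i: "i \<le> t" "j = c + t - i"
      using \<open>c \<le> j\<close> \<open>j \<le> c + t\<close> by (auto simp: i_def)
    have "coeff (alt_sum t c :: 'a poly) j = (\<Sum>i' = 0..t. if i' = i then (- 1) ^ i' else 0)"
      unfolding alt_sum_def coeff_sum by (rule sum.cong) (use i in auto)
    also have "\<dots> = (- 1) ^ i"
      using i by simp
    finally show ?thesis
      using P f[OF i(1)] i(2) j by (simp add: coeff_monom_mult coeff_pcompose_monom)
  qed
qed

text \<open>One further factor \<open>1 + x\<close> completes \<open>(1 + x)^P = 1 + x^P\<close> and
  leaves two terms, at \<open>k - 1 + P c\<close> and \<open>k - 1 + P (c + t + 1)\<close>. All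
  exponents that count lie between them, where the quotient alternates as \<open>alt_poly\<close>
  does.\<close>

lemma form_eq_alternating:
  assumes char: "prime CHAR('a::field)" "P = CHAR('a) ^ n"
    and "0 < k" "R < k" "S < P"
  shows "form_eq ((c + t + 1) * P + R) ((b + t) * P + S) ((c + b + t) * P + (k - 1) + (P - 1))
    ([:1, 1:] ^ (P - 1) * (monom 1 (k - 1) * pcompose (alt_sum t c) (monom 1 P)))
    (Polynomial.smult ((- 1) ^ (R + k - 1)) (alt_poly ((c + t + 1) * P + R)) :: 'a poly)"
proof -
  define q :: "'a poly" where
    "q = [:1, 1:] ^ (P - 1) * (monom 1 (k - 1) * pcompose (alt_sum t c) (monom 1 P))"
  have P: "P > 0"
    using char by (auto simp: prime_gt_0_nat)
  have sgn: "(- 1 :: 'a) ^ (j * P) = (- 1) ^ j" for j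
    by (metis minus_one_power_CHAR[OF char] mult.commute power_mult)
  have "[:1, 1:] * q = monom 1 (k - 1) * ([:1, 1:] ^ (1 * P) * pcompose (alt_sum t c) (monom 1 P))"
  proof -
    have "[:1, 1 :: 'a:] ^ (1 * P) = [:1, 1:] * [:1, 1:] ^ (P - 1)"
      using P by (cases P) auto
    then show ?thesis
      unfolding q_def by (simp only: mult.assoc mult.left_commute)
  qed
  also have "\<dots> = monom 1 (k - 1) * pcompose (monom 1 (c + t + 1) + monom ((- 1) ^ t) c) (monom 1 P)"
    unfolding one_plus_power_mult_pcompose[OF char] by (simp only: power_one_right one_plus_mult_alt_sum)
  also have "\<dots> = monom ((- 1) ^ t) (k - 1 + P * c) + monom 1 (k - 1 + P * (c + t + 1))"
    by (simp only: pcompose_add pcompose_monom distrib_left mult_monom mult_1 add.commute)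
  finally have q: "[:1, 1:] * q = \<dots>" .
  show ?thesis
    unfolding form_eq_def q_def[symmetric]
  proof (intro allI impI)
    fix l assume l: "l < (c + t + 1) * P + R"
      "(c + b + t) * P + (k - 1) + (P - 1) < l + ((b + t) * P + S)"
    have l0: "k - 1 + P * c \<le> l"
      using l(2) \<open>S < P\<close> by (simp add: algebra_simps)
    have "l < k - 1 + P * (c + t + 1)"
      using l(1) \<open>R < k\<close> by (simp add: mult.commute)
    then have "coeff q l = (- 1) ^ (t + (l - (k - 1 + P * c)))"
      unfolding power_add using coeff_alternating[OF q] l0 by simp
    also have "\<dots> = (- 1) ^ (R + k - 1 + ((c + t + 1) * P + R - 1 - l))" (is "_ ^ ?m = _ ^ ?m'")
    proof -
      \<comment> \<open>Because \<open>(-1)^P = -1\<close>, the power of -1 with this exponent is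
        -1; so the two parities agree unless \<open>-1 = 1\<close>.\<close>
      have "?m + ?m' + 1 = 2 * R + t + (t + 1) * P"
        using l0 l(1) \<open>0 < k\<close> by (simp add: algebra_simps)
      then have "(- 1 :: 'a) ^ (?m + ?m' + 1) = (- 1) ^ (2 * R + t + (t + 1) * P)"
        by (rule arg_cong)
      also have "\<dots> = - 1"
        unfolding power_add sgn by simp
      finally have "even (?m + ?m') \<or> (- 1 :: 'a) = 1"
        by (cases "even (?m + ?m')") auto
      then show ?thesis
      proof
        assume "even (?m + ?m')"
        then show ?thesis
          by (cases "even ?m") (simp_all only: even_add minus_one_power_iff if_True if_False)
      next
        assume "(- 1 :: 'a) = 1"
        then show ?thesis by (simp only: power_one)
      qed
    qed
    finally have "coeff q l = (- 1) ^ ?m'" .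
    then show "coeff q l = coeff (Polynomial.smult ((- 1) ^ (R + k - 1)) (alt_poly ((c + t + 1) * P + R))) l"
      using l(1) by (simp only: coeff_smult coeff_alt_poly if_True power_add)
  qed
qed

section \<open>Subspaces of function spaces\<close>

lemma fscale_apply [simp]: "fscale c w i = c * w i"
  by (simp add: fscale_def)

lemma Vsp_iff: "y \<in> Vsp m \<longleftrightarrow> (\<forall>k. k \<notin> {1..m} \<longrightarrow> y k = 0)"
proof
  assume "y \<in> Vsp m"
  then show "\<forall>k. k \<notin> {1..m} \<longrightarrow> y k = 0"
    unfolding Vsp_def
    by (induction rule: fun_space.span_induct_alt) (auto simp: bvec_def)
next
  assume y: "\<forall>k. k \<notin> {1..m} \<longrightarrow> y k = 0"
  have "(\<Sum>i = 1..m. fscale (y i) (bvec i)) \<in> Vsp m"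
    unfolding Vsp_def
    by (intro fun_space.span_sum fun_space.span_scale fun_space.span_base) auto
  moreover have "(\<Sum>i = 1..m. fscale (y i) (bvec i)) = y"
  proof
    fix k
    have "(\<Sum>i = 1..m. fscale (y i) (bvec i)) k = (\<Sum>i = 1..m. if i = k then y i else 0)"
      unfolding sum_fun_apply by (rule sum.cong) (auto simp: bvec_def)
    then show "(\<Sum>i = 1..m. fscale (y i) (bvec i)) k = y k"
      using y by (auto simp: sum.delta)
  qed
  ultimately show "y \<in> Vsp m" by simp
qed

lemma subspace_Vsp: "fun_space.subspace (Vsp m)"
  by (simp add: Vsp_def)

lemma subspace_Tsp: "fun_space.subspace (Tsp r s)"
  by (simp add: Tsp_def)

lemma bvec_in_Vsp: "i \<le> m \<Longrightarrow> bvec i \<in> Vsp m"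
  by (auto simp: Vsp_iff bvec_def)

lemma Vsp_mono: "m \<le> m' \<Longrightarrow> Vsp m \<subseteq> Vsp m'"
  by (auto simp: Vsp_iff subset_iff)

lemma tensor_in_Tsp: "x \<in> Vsp r \<Longrightarrow> y \<in> Vsp s \<Longrightarrow> tensor x y \<in> Tsp r s"
  unfolding Tsp_def by (auto intro: fun_space.span_base)

lemma linear_on_0: "linear_on V f \<Longrightarrow> fun_space.subspace V \<Longrightarrow> f 0 = 0"
  using linear_on_sum[of V f "{}" undefined undefined] by simp

lemma linear_on_sum_scale:
  assumes "linear_on V f" "fun_space.subspace V" "\<And>i. i \<in> I \<Longrightarrow> u i \<in> V" "finite I"
  shows "f (\<Sum>i\<in>I. fscale (c i) (u i)) = (\<Sum>i\<in>I. fscale (c i) (f (u i)))"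
  using linear_on_sum[OF assms(1,2,4)] assms(3) by blast

lemma tensor_0_left [simp]: "tensor 0 y = 0"
  and tensor_0_right [simp]: "tensor x 0 = 0"
  by (auto simp: tensor_def fun_eq_iff)

lemma tensor_add_left: "tensor (x + x') y = tensor x y + tensor x' y"
  and tensor_add_right: "tensor x (y + y') = tensor x y + tensor x y'"
  by (auto simp: tensor_def fun_eq_iff algebra_simps)

lemma bvec_0 [simp]: "bvec 0 = 0"
  by (auto simp: bvec_def fun_eq_iff)

section \<open>The modules of the cyclic group\<close>

locale jordan_module =
  fixes G :: "('g, 'm) monoid_scheme" and g :: 'g
    and act :: "'g \<Rightarrow> (nat \<Rightarrow> 'f::field) \<Rightarrow> nat \<Rightarrow> 'f" and q :: nat
  assumes G: "group G" and g: "g \<in> carrier G" and gen: "generate G {g} = carrier G"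
    and FG: "FG_module G (Vsp q) act"
    and act_1: "act g (bvec 1) = bvec 1"
    and act_Suc: "\<And>i. i \<in> {1<..q} \<Longrightarrow> act g (bvec i) = bvec (i - 1) + bvec i"
begin

lemma act_lin: "h \<in> carrier G \<Longrightarrow> linear_on (Vsp q) (act h)"
  using FG by (simp add: FG_module_def)

lemma act_0: "h \<in> carrier G \<Longrightarrow> act h 0 = 0"
  using linear_on_0[OF act_lin subspace_Vsp] .

lemma act_mult: "h \<in> carrier G \<Longrightarrow> k \<in> carrier G \<Longrightarrow> y \<in> Vsp q \<Longrightarrow> act (h \<otimes>\<^bsub>G\<^esub> k) y = act h (act k y)"
  using FG by (simp add: FG_module_def)

lemma act_one: "y \<in> Vsp q \<Longrightarrow> act \<one>\<^bsub>G\<^esub> y = y"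
  using FG by (simp add: FG_module_def)

lemma act_g_bvec: "i \<le> q \<Longrightarrow> act g (bvec i) = bvec (i - 1) + bvec i"
  using act_1 act_Suc[of i] act_0[OF g] by (cases i; cases "i = 1") auto

lemma act_expand:
  assumes "h \<in> carrier G" "m \<le> q" "y \<in> Vsp m"
  shows "act h y = (\<Sum>i = 1..m. fscale (y i) (act h (bvec i)))"
  by (subst Vsp_expand[OF assms(3)], rule linear_on_sum_scale[OF act_lin[OF assms(1)] subspace_Vsp])
    (use assms in \<open>auto intro: bvec_in_Vsp\<close>)

lemma act_in_Vsp_if_bvec:
  assumes "h \<in> carrier G" "m \<le> q" "y \<in> Vsp m" and "\<And>i. i \<le> m \<Longrightarrow> act h (bvec i) \<in> Vsp i"
  shows "act h y \<in> Vsp m"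
proof -
  have "act h (bvec i) \<in> Vsp m" if "i \<in> {1..m}" for i
    using assms(4)[of i] Vsp_mono[of i m] that by auto
  then show ?thesis
    unfolding act_expand[OF assms(1-3)]
    by (intro fun_space.subspace_sum fun_space.subspace_scale subspace_Vsp)
qed

text \<open>Applying the inverse to \<open>g v_(i+1) = v_i + v_(i+1)\<close> gives the recursion.
  The inverse is among the cases of induction over the generated group.\<close>

lemma act_inv_g_bvec: "i \<le> q \<Longrightarrow> act (inv\<^bsub>G\<^esub> g) (bvec i) \<in> Vsp i"
proof (induction i)
  case 0
  then show ?case
    by (simp only: bvec_0 act_0[OF group.inv_closed[OF G g]] fun_space.subspace_0[OF subspace_Vsp])
next
  case (Suc i)
  let ?h = "inv\<^bsub>G\<^esub> g"
  have h: "?h \<in> carrier G"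
    by (rule group.inv_closed[OF G g])
  have mem: "bvec i \<in> Vsp q" "bvec (Suc i) \<in> Vsp q"
    using Suc.prems by (auto intro: bvec_in_Vsp)
  have "bvec (Suc i) = act (?h \<otimes>\<^bsub>G\<^esub> g) (bvec (Suc i))"
    using act_one[OF mem(2)] by (simp only: group.l_inv[OF G g])
  also have "\<dots> = act ?h (bvec i + bvec (Suc i))"
    unfolding act_mult[OF h g mem(2)] using act_g_bvec[OF Suc.prems] by simp
  also have "\<dots> = act ?h (bvec i) + act ?h (bvec (Suc i))"
    using act_lin[OF h] mem unfolding linear_on_def by blast
  finally have "act ?h (bvec (Suc i)) = bvec (Suc i) - act ?h (bvec i)"
    by (simp add: algebra_simps)
  moreover have "act ?h (bvec i) \<in> Vsp (Suc i)"
    using Suc Vsp_mono[of i "Suc i"] by auto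
  ultimately show ?case
    using bvec_in_Vsp[of "Suc i" "Suc i"] fun_space.subspace_diff[OF subspace_Vsp] by (metis order.refl)
qed

lemma act_Vsp:
  assumes "h \<in> carrier G" "m \<le> q" "y \<in> Vsp m"
  shows "act h y \<in> Vsp m"
proof -
  have "h \<in> generate G {g}" using assms gen by simp
  then show ?thesis
    using assms(2,3)
  proof (induction h arbitrary: y)
    case one
    then have "y \<in> Vsp q"
      using Vsp_mono[of m q] by auto
    then show ?case
      using one by (simp only: act_one)
  next
    case (incl h)
    have "act g (bvec i) \<in> Vsp i" if "i \<le> m" for i
      unfolding act_g_bvec[OF order.trans[OF that incl(2)]]
      by (intro fun_space.subspace_add subspace_Vsp bvec_in_Vsp) auto
    with incl show ?case
      using act_in_Vsp_if_bvec[of g m y] g by auto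
  next
    case (inv h)
    have "act (inv\<^bsub>G\<^esub> g) (bvec i) \<in> Vsp i" if "i \<le> m" for i
      using act_inv_g_bvec[of i] that inv(2) by simp
    with inv show ?case
      using act_in_Vsp_if_bvec[of "inv\<^bsub>G\<^esub> g" m y] group.inv_closed[OF G g] by auto
  next
    case (eng h k y)
    then have "act h (act k y) \<in> Vsp m" by blast
    moreover have "h \<in> carrier G" "k \<in> carrier G" "y \<in> Vsp q"
      using eng.hyps gen eng.prems Vsp_mono[of m q] by auto
    ultimately show ?case
      by (simp only: act_mult)
  qed
qed

text \<open>In coordinates \<open>g - 1\<close> is a shift. Coordinate 0 belongs to no basis vector,
  so the shift must not fill it.\<close>

lemma act_g_apply:
  assumes "m \<le> q" "y \<in> Vsp m"
  shows "act g y k = y k + (if k = 0 then 0 else y (Suc k))"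
proof -
  have y: "y i = 0" if "i \<notin> {1..m}" for i
    using assms(2) that by (simp add: Vsp_iff)
  have "act g y k = (\<Sum>i = 1..m. fscale (y i) (act g (bvec i)) k)"
    unfolding act_expand[OF g assms] sum_fun_apply ..
  also have "\<dots> = (\<Sum>i = 1..m. (if i = Suc k then if k = 0 then 0 else y (Suc k) else 0) + (if i = k then y k else 0))"
  proof (rule sum.cong[OF refl])
    fix i assume i: "i \<in> {1..m}"
    then have "act g (bvec i) k = bvec (i - 1) k + bvec i k"
      using act_g_bvec[of i] assms(1) by simp
    then show "fscale (y i) (act g (bvec i)) k
        = (if i = Suc k then if k = 0 then 0 else y (Suc k) else 0) + (if i = k then y k else 0)"
      using i by (simp add: bvec_def) linarith
  qed
  also have "\<dots> = y k + (if k = 0 then 0 else y (Suc k))"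
    using y[of 0] y[of k] y[of "Suc k"] unfolding sum.distrib by (simp add: sum.delta)
  finally show ?thesis .
qed

end

section \<open>Tensor products as spaces of forms\<close>

locale tensor_module = jordan_module G g act q
  for G :: "('g, 'm) monoid_scheme" and g :: 'g
    and act :: "'g \<Rightarrow> (nat \<Rightarrow> 'f::field) \<Rightarrow> nat \<Rightarrow> 'f" and q :: nat +
  fixes r s n :: nat
  assumes r: "r \<le> q" and s: "s \<le> q"
begin

abbreviation v :: "nat \<Rightarrow> nat \<Rightarrow> nat \<times> nat \<Rightarrow> 'f" where
  "v \<equiv> vij G g act n"

definition Delta :: "(nat \<times> nat \<Rightarrow> 'f) \<Rightarrow> nat \<times> nat \<Rightarrow> 'f" where
  "Delta w = Tact r s act g w - w"

text \<open>Truncated subtraction gives index 0, hence the zero vector, as soon as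
  \<open>r \<le> k\<close> or \<open>s \<le> h - k\<close>. This is the reduction modulo
  \<open>(X^r, Y^s)\<close>.\<close>

definition form :: "nat \<Rightarrow> 'f poly \<Rightarrow> nat \<times> nat \<Rightarrow> 'f" where
  "form h f = (\<Sum>k\<le>h. fscale (coeff f k) (v (r - k) (s - (h - k))))"

lemma int_pow_in_carrier: "g [^]\<^bsub>G\<^esub> (e :: int) \<in> carrier G"
  by (rule group.int_pow_closed[OF G g])

lemma v_0_left: "v 0 j = 0" and v_0_right: "v i 0 = 0"
  unfolding vij_def by (simp_all only: bvec_0 act_0[OF int_pow_in_carrier] tensor_0_left tensor_0_right)

lemma v_in_Tsp: "i \<le> r \<Longrightarrow> j \<le> s \<Longrightarrow> v i j \<in> Tsp r s"
  unfolding vij_def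
  by (intro tensor_in_Tsp bvec_in_Vsp act_Vsp int_pow_in_carrier s)

lemma Tact_add: "Tact r s act h (w + w') = Tact r s act h w + Tact r s act h w'"
  by (simp add: fun_eq_iff Tact_def sum_fun_apply sum.distrib distrib_right)

lemma Tact_scale: "Tact r s act h (fscale c w) = fscale c (Tact r s act h w)"
  by (simp add: fun_eq_iff Tact_def sum_fun_apply sum_distrib_left mult.assoc)

lemma Delta_add: "Delta (w + w') = Delta w + Delta w'"
  by (simp only: Delta_def Tact_add add_diff_add)

lemma Delta_scale: "Delta (fscale c w) = fscale c (Delta w)"
  by (simp only: Delta_def Tact_scale fun_space.scale_right_diff_distrib)

lemma Delta_0: "Delta 0 = 0"
  using Delta_scale[of 0 0] by (simp only: fun_space.scale_zero_left)

lemma Delta_sum_scale: "Delta (\<Sum>i\<in>I. fscale (c i) (u i)) = (\<Sum>i\<in>I. fscale (c i) (Delta (u i)))"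
  by (induction I rule: infinite_finite_induct) (simp_all only: sum.infinite sum.empty sum.insert Delta_0 Delta_add Delta_scale not_False_eq_True)

lemma funpow_Delta_0: "(Delta ^^ e) 0 = 0"
  by (induction e) (simp_all only: funpow.simps comp_apply id_apply Delta_0)

lemma funpow_Delta_scale: "(Delta ^^ e) (fscale c w) = fscale c ((Delta ^^ e) w)"
  by (induction e) (simp_all only: funpow.simps comp_apply id_apply Delta_scale)

text \<open>The twist in the second factor makes the formula symmetric: \<open>g g^(n-i)\<close> is
  read as \<open>g^(n-(i-1))\<close> next to \<open>v_(i-1)\<close>, and as \<open>g^(n-i) g\<close>
  next to \<open>v_i\<close>.\<close>

lemma Delta_v:
  assumes "i \<le> r" "j \<le> s"
  shows "Delta (v i j) = v (i - 1) j + v i (j - 1)"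
proof (cases "i = 0 \<or> j = 0")
  case True
  then show ?thesis
    by (elim disjE) (simp_all only: v_0_left v_0_right diff_0_eq_0 add_0_left Delta_0)
next
  case False
  let ?h = "\<lambda>e :: int. g [^]\<^bsub>G\<^esub> e"
  have mem: "bvec j \<in> Vsp q" "bvec (j - 1) \<in> Vsp q"
    using assms s by (auto intro: bvec_in_Vsp)
  define y where "y = act (?h (int n - int i)) (bvec j)"
  define y' where "y' = act (?h (int n - int i)) (bvec (j - 1))"
  have "y \<in> Vsp s"
    unfolding y_def by (intro act_Vsp int_pow_in_carrier s bvec_in_Vsp assms)
  have eq: "act g y = act (?h (int n - int (i - 1))) (bvec j)"
  proof -
    have "?h (int n - int (i - 1)) = g \<otimes>\<^bsub>G\<^esub> ?h (int n - int i)"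
      using group.int_pow_mult[OF G g, of 1 "int n - int i"] group.int_pow_1[OF G g] False
      by (simp add: of_nat_diff algebra_simps)
    then show ?thesis
      unfolding y_def using act_mult[OF g int_pow_in_carrier mem(1)] by simp
  qed
  have "act g y = act (?h (int n - int i)) (act g (bvec j))"
  proof -
    have "g \<otimes>\<^bsub>G\<^esub> ?h (int n - int i) = ?h (int n - int i) \<otimes>\<^bsub>G\<^esub> g"
      using group.int_pow_mult[OF G g, of 1 "int n - int i"] group.int_pow_mult[OF G g, of "int n - int i" 1]
        group.int_pow_1[OF G g] by (simp add: add.commute)
    then show ?thesis
      unfolding y_def using act_mult[OF g int_pow_in_carrier mem(1)] act_mult[OF int_pow_in_carrier g mem(1)]
      by metis
  qed
  also have "act g (bvec j) = bvec (j - 1) + bvec j"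
    using act_g_bvec assms s by simp
  also have "act (?h (int n - int i)) \<dots> = y' + y"
    using act_lin[OF int_pow_in_carrier] mem unfolding linear_on_def y_def y'_def by blast
  finally have eq': "act g y = y' + y" .
  have "Tact r s act g (v i j) = tensor (act g (bvec i)) (act g y)"
    unfolding vij_def y_def[symmetric]
    by (rule Tact_tensor[of q act g r s, OF act_lin[OF g] r s]) (use assms \<open>y \<in> Vsp s\<close> in \<open>auto intro: bvec_in_Vsp\<close>)
  also have "\<dots> = tensor (bvec (i - 1)) (act g y) + tensor (bvec i) (y' + y)"
    using act_g_bvec[of i] assms(1) r unfolding eq'[symmetric] by (simp only: tensor_add_left)
  also have "\<dots> = v (i - 1) j + v i (j - 1) + v i j"
    unfolding vij_def eq y_def[symmetric] y'_def[symmetric] by (simp only: tensor_add_right add.assoc)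
  finally show ?thesis
    unfolding Delta_def by (simp only: add_diff_cancel_right')
qed

lemma Delta_form:
  assumes "degree f \<le> h"
  shows "Delta (form h f) = form (Suc h) ([:1, 1:] * f)"
proof -
  let ?u = "\<lambda>k. v (r - k) (s - (Suc h - k))"
  have "Delta (form h f) = (\<Sum>k\<le>h. fscale (coeff f k) (?u (Suc k)) + fscale (coeff f k) (?u k))"
    unfolding form_def Delta_sum_scale
  proof (rule sum.cong[OF refl])
    fix k assume "k \<in> {..h}"
    then have "s - (h - k) - 1 = s - (Suc h - k)" "r - k - 1 = r - Suc k" "h - k = Suc h - Suc k"
      by auto
    then show "fscale (coeff f k) (Delta (v (r - k) (s - (h - k))))
        = fscale (coeff f k) (?u (Suc k)) + fscale (coeff f k) (?u k)"
      unfolding Delta_v[OF diff_le_self diff_le_self] by (simp only: fun_space.scale_right_distrib)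
  qed
  \<comment> \<open>The summand added at \<open>Suc h\<close> is zero by the bound on the
    degree.\<close>
  also have "\<dots> = (\<Sum>k\<le>h. fscale (coeff f k) (?u (Suc k))) + (\<Sum>k\<le>Suc h. fscale (coeff f k) (?u k))"
    using assms by (simp only: sum.distrib sum.atMost_Suc coeff_eq_0[of f "Suc h"] le_imp_less_Suc
        fun_space.scale_zero_left add_0_right)
  also have "(\<Sum>k\<le>h. fscale (coeff f k) (?u (Suc k))) = (\<Sum>k\<le>Suc h. fscale (coeff (pCons 0 f) k) (?u k))"
    by (simp only: sum.atMost_Suc_shift coeff_pCons_0 coeff_pCons_Suc fun_space.scale_zero_left add_0_left)
  also have "\<dots> + (\<Sum>k\<le>Suc h. fscale (coeff f k) (?u k)) = form (Suc h) ([:1, 1:] * f)"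
    unfolding form_def by (simp add: fun_space.scale_left_distrib sum.distrib add.commute del: sum.atMost_Suc)
  finally show ?thesis .
qed

lemma degree_one_plus_power_mult_le:
  "degree ([:1, 1:] ^ e * f :: 'f poly) \<le> e + degree f"
  using degree_mult_le[of "[:1, 1:] ^ e" f] by (simp add: degree_power_eq)

lemma funpow_Delta_form:
  assumes "degree f \<le> h"
  shows "(Delta ^^ e) (form h f) = form (h + e) ([:1, 1:] ^ e * f)"
proof (induction e)
  case (Suc e)
  have "(Delta ^^ Suc e) (form h f) = Delta (form (h + e) ([:1, 1:] ^ e * f))"
    using Suc by simp
  also have "\<dots> = form (Suc (h + e)) ([:1, 1:] * ([:1, 1:] ^ e * f))"
    by (rule Delta_form) (use degree_one_plus_power_mult_le[of e f] assms in simp)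
  finally show ?case by (simp only: power_Suc mult.assoc add_Suc_right)
qed simp

lemma form_cong:
  assumes "form_eq r s h f f'"
  shows "form h f = form h f'"
  unfolding form_def
proof (rule sum.cong[OF refl])
  fix k assume "k \<in> {..h}"
  show "fscale (coeff f k) (v (r - k) (s - (h - k))) = fscale (coeff f' k) (v (r - k) (s - (h - k)))"
  proof (cases "k < r \<and> h < k + s")
    case True
    with assms show ?thesis by (simp add: form_eq_def)
  next
    case False
    then have "r - k = 0 \<or> s - (h - k) = 0" by auto
    then have "v (r - k) (s - (h - k)) = 0"
      by (elim disjE) (simp_all only: v_0_left v_0_right)
    then show ?thesis by (simp only: fun_space.scale_zero_right)
  qed
qed

lemma form_add: "form h (f + f') = form h f + form h f'"
  by (simp only: form_def coeff_add fun_space.scale_left_distrib sum.distrib)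

lemma form_smult: "form h (Polynomial.smult c f) = fscale c (form h f)"
  by (simp only: form_def coeff_smult fun_space.scale_sum_right fun_space.scale_scale)

lemma form_0: "form h 0 = 0"
  by (simp only: form_def coeff_0 fun_space.scale_zero_left sum.neutral_const)

lemma form_sum: "form h (\<Sum>i\<in>I. f i) = (\<Sum>i\<in>I. form h (f i))"
  by (induction I rule: infinite_finite_induct)
    (simp_all only: sum.infinite sum.empty sum.insert form_0 form_add not_False_eq_True)

lemma form_monom:
  assumes "k \<le> h"
  shows "form h (monom c k) = fscale c (v (r - k) (s - (h - k)))"
proof -
  have "form h (monom c k) = (\<Sum>k'\<in>{k}. fscale (coeff (monom c k) k') (v (r - k') (s - (h - k'))))"
    unfolding form_def
    by (rule sum.mono_neutral_right) (use assms in \<open>auto simp: fun_eq_iff\<close>)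
  then show ?thesis by simp
qed

lemma form_in_Tsp: "form h f \<in> Tsp r s"
  unfolding form_def
  by (intro fun_space.subspace_sum fun_space.subspace_scale subspace_Tsp v_in_Tsp diff_le_self)

lemma v_in_Dsp:
  assumes "i \<le> r" "j \<le> s" "i = 0 \<or> j = 0 \<or> i + j = d + 1"
  shows "v i j \<in> Dsp v r s d"
proof (cases "i = 0 \<or> j = 0")
  case True
  then have "v i j = 0"
    by (elim disjE) (simp_all only: v_0_left v_0_right)
  then show ?thesis
    by (simp only: Dsp_def fun_space.span_zero)
next
  case False
  then show ?thesis
    unfolding Dsp_def using assms False
    by (intro fun_space.span_base CollectI exI[of _ i] exI[of _ j]) auto
qed

lemma form_in_Dsp:
  assumes "h + d + 1 = r + s"
  shows "form h f \<in> Dsp v r s d"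
  unfolding form_def
proof (intro fun_space.subspace_sum fun_space.subspace_scale)
  fix k assume "k \<in> {..h}"
  then show "v (r - k) (s - (h - k)) \<in> Dsp v r s d"
    using assms by (intro v_in_Dsp) auto
qed (simp_all add: Dsp_def)

lemma Delta_Dsp:
  assumes "w \<in> Dsp v r s (Suc d)"
  shows "Delta w \<in> Dsp v r s d"
  using assms unfolding Dsp_def[of v r s "Suc d"]
proof (induction rule: fun_space.span_induct_alt)
  case base
  then show ?case by (simp only: Delta_0 Dsp_def fun_space.span_zero)
next
  case (step c w w')
  then obtain i j where ij: "w = v i j" "i \<le> r" "j \<le> s" "i + j = Suc d + 1"
    by blast
  have "v (i - 1) j \<in> Dsp v r s d" "v i (j - 1) \<in> Dsp v r s d"
    using ij(2-) by (intro v_in_Dsp; linarith)+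
  then have "Delta w \<in> Dsp v r s d"
    unfolding ij(1) Delta_v[OF ij(2,3)] Dsp_def[of v r s d] by (rule fun_space.span_add)
  then have "fscale c (Delta w) \<in> Dsp v r s d"
    unfolding Dsp_def[of v r s d] by (rule fun_space.span_scale)
  from this step(2) show ?case
    unfolding Delta_add Delta_scale Dsp_def[of v r s d] by (rule fun_space.span_add)
qed

lemma funpow_Delta_Dsp:
  "w \<in> Dsp v r s (d + e) \<Longrightarrow> (Delta ^^ e) w \<in> Dsp v r s d"
proof (induction e arbitrary: d)
  case (Suc e)
  then have "(Delta ^^ e) w \<in> Dsp v r s (Suc d)"
    by simp
  then show ?case
    using Delta_Dsp by simp
qed simp

lemma xvec_eq_form:
  assumes "d \<le> r" "d \<le> s"
  shows "xvec v d = form (r + s - 1 - d) (alt_poly r)"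
proof -
  let ?h = "r + s - 1 - d"
  let ?u = "\<lambda>i. fscale ((- 1) ^ (i - 1)) (v i (d + 1 - i))"
  have "form ?h (alt_poly r) = (\<Sum>k<r. fscale (coeff (alt_poly r) k) (v (r - k) (s - (?h - k))))"
    unfolding form_def
  proof (rule sum.mono_neutral_right)
    show "\<forall>k\<in>{..?h} - {..<r}. fscale (coeff (alt_poly r) k) (v (r - k) (s - (?h - k))) = 0"
    proof
      fix k assume "k \<in> {..?h} - {..<r}"
      then have "coeff (alt_poly r :: 'f poly) k = 0" by (simp add: coeff_alt_poly)
      then show "fscale (coeff (alt_poly r) k) (v (r - k) (s - (?h - k))) = 0"
        by (simp only: fun_space.scale_zero_left)
    qed
    show "{..<r} \<subseteq> {..?h}"
      using assms by auto
  qed simp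
  also have "\<dots> = sum ?u {1..r}"
  proof (rule sum.reindex_bij_witness[of _ "\<lambda>i. r - i" "\<lambda>k. r - k"])
    fix k assume k: "k \<in> {..<r}"
    have 1: "s - (?h - k) = d + 1 - (r - k)"
      using assms k by (cases "r \<le> d + k") auto
    have 2: "coeff (alt_poly r :: 'f poly) k = (- 1) ^ (r - k - 1)"
      using k by (simp add: coeff_alt_poly)
    show "?u (r - k) = fscale (coeff (alt_poly r) k) (v (r - k) (s - (?h - k)))"
      by (simp only: 1 2)
  qed auto
  also have "\<dots> = sum ?u {1..d}"
  proof (rule sum.mono_neutral_right)
    show "\<forall>i\<in>{1..r} - {1..d}. ?u i = 0"
    proof
      fix i assume "i \<in> {1..r} - {1..d}"
      then have "d + 1 - i = 0" by auto
      then show "?u i = 0" by (simp only: v_0_right fun_space.scale_zero_right)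
    qed
  qed (use assms in auto)
  finally show ?thesis by (simp add: xvec_def)
qed

text \<open>Division by \<open>1 + x\<close> leaves the remainder \<open>f(-1)\<close>: modulo the
  image of \<open>Delta\<close>, every form of degree \<open>h\<close> is a multiple of
  \<open>Y^h\<close>.\<close>

lemma form_mod_Delta:
  assumes "degree f \<le> h"
  shows "\<exists>u\<in>Tsp r s. form h f = fscale (poly f (- 1)) (form h 1) + Delta u"
proof -
  let ?g = "synthetic_div f (- 1)" and ?a = "poly f (- 1)"
  have "f = Polynomial.smult ?a 1 + [:1, 1:] * ?g"
    using synthetic_div_correct'[of "- 1" f] by (simp add: add.commute)
  then have "form h f = form h (Polynomial.smult ?a 1 + [:1, 1:] * ?g)"
    by simp
  then have *: "form h f = fscale ?a (form h 1) + form h ([:1, 1:] * ?g)"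
    by (simp only: form_add form_smult)
  show ?thesis
  proof (cases h)
    case 0
    then have "?g = 0"
      using assms by (simp add: synthetic_div_eq_0_iff)
    then have "form h ([:1, 1:] * ?g) = Delta 0"
      by (simp only: mult_zero_right form_0 Delta_0)
    with * show ?thesis
      by (intro bexI[of _ 0] fun_space.subspace_0[OF subspace_Tsp]) (simp only:)
  next
    case (Suc h')
    then have "form h ([:1, 1:] * ?g) = Delta (form h' ?g)"
      using Delta_form[of ?g h'] assms by (simp add: degree_synthetic_div)
    with * show ?thesis
      by (intro bexI[OF _ form_in_Tsp]) (simp only:)
  qed
qed

section \<open>Spanning and independence in the tensor product\<close>

lemma act_inverse:
  assumes "h \<in> carrier G" "y \<in> Vsp q"
  shows "act (inv\<^bsub>G\<^esub> h) (act h y) = y" "act h (act (inv\<^bsub>G\<^esub> h) y) = y"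
  using act_mult[OF group.inv_closed[OF G assms(1)] assms] act_mult[OF assms(1) group.inv_closed[OF G assms(1)] assms(2)]
    act_one[OF assms(2)] group.l_inv[OF G assms(1)] group.r_inv[OF G assms(1)]
  by metis+

text \<open>For fixed \<open>i\<close> the second factors of the \<open>v i j\<close> are the images
  of a basis under the automorphism \<open>g^(n-i)\<close>, so they span again.\<close>

lemma Tsp_eq_span_v: "Tsp r s \<subseteq> fun_space.span {v i j | i j. i \<le> r \<and> j \<le> s}"
  unfolding Tsp_def
proof (rule fun_space.span_minimal[OF _ fun_space.subspace_span], rule subsetI)
  fix w :: "nat \<times> nat \<Rightarrow> 'f" assume "w \<in> {tensor x y |x y. x \<in> Vsp r \<and> y \<in> Vsp s}"
  then obtain x y where w: "w = tensor x y" and x: "x \<in> Vsp r" and y: "y \<in> Vsp s"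
    by blast
  let ?B = "{v i j | i j. i \<le> r \<and> j \<le> s}"
  have b: "tensor (bvec i) y \<in> fun_space.span ?B" if "i \<le> r" for i
  proof -
    define h where "h = g [^]\<^bsub>G\<^esub> (int n - int i)"
    define y' where "y' = act (inv\<^bsub>G\<^esub> h) y"
    have h: "h \<in> carrier G"
      unfolding h_def by (rule int_pow_in_carrier)
    have y': "y' \<in> Vsp s"
      unfolding y'_def by (intro act_Vsp group.inv_closed G h s y)
    have "y = act h y'"
      unfolding y'_def using act_inverse(2)[OF h] y Vsp_mono[OF s] by auto
    also have "\<dots> = (\<Sum>j = 1..s. fscale (y' j) (act h (bvec j)))"
      by (rule act_expand[OF h s y'])
    finally have "tensor (bvec i) y = (\<Sum>j = 1..s. fscale (y' j) (v i j))"
      by (auto simp: fun_eq_iff tensor_def vij_def h_def sum_fun_apply sum_distrib_left mult_ac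
          intro!: sum.cong)
    also have "\<dots> \<in> fun_space.span ?B"
      by (intro fun_space.span_sum fun_space.span_scale fun_space.span_base) (use that in auto)
    finally show ?thesis .
  qed
  have "w = (\<Sum>i = 1..r. fscale (x i) (tensor (bvec i) y))"
  proof
    fix z :: "nat \<times> nat"
    obtain i j where z: "z = (i, j)" by fastforce
    have "x i = (\<Sum>i' = 1..r. fscale (x i') (bvec i')) i"
      by (rule fun_cong[OF Vsp_expand[OF x]])
    then show "w z = (\<Sum>i = 1..r. fscale (x i) (tensor (bvec i) y)) z"
      by (simp add: w z tensor_def sum_fun_apply sum_distrib_right mult.assoc)
  qed
  also have "\<dots> \<in> fun_space.span ?B"
    by (intro fun_space.span_sum fun_space.span_scale b) simp
  finally show "w \<in> fun_space.span ?B" .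
qed

text \<open>In the coordinates \<open>(1, j)\<close> only the summand \<open>v 1 d\<close> of
  \<open>xvec v d\<close> is visible, and it shows the image of \<open>bvec d\<close> under the
  invertible \<open>g^(n-1)\<close>.\<close>

lemma xvec_independent:
  assumes "m \<le> s" and zero: "(\<Sum>d = 1..m. fscale (c d) (xvec v d)) = 0" and d: "d \<in> {1..m}"
  shows "c d = 0"
proof -
  define h where "h = g [^]\<^bsub>G\<^esub> (int n - int 1)"
  have h: "h \<in> carrier G"
    unfolding h_def by (rule int_pow_in_carrier)
  define u :: "nat \<Rightarrow> 'f" where "u = (\<Sum>d = 1..m. fscale (c d) (bvec d))"
  have bvec: "bvec d \<in> Vsp q" if "d \<in> {1..m}" for d
    using that assms(1) s by (auto intro: bvec_in_Vsp)
  have u: "u \<in> Vsp q"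
    unfolding u_def by (intro fun_space.subspace_sum fun_space.subspace_scale subspace_Vsp bvec)
  have xvec_1: "xvec v d (1, j) = act h (bvec d) j" if "d \<in> {1..m}" for d j
  proof -
    have "xvec v d (1, j) = (\<Sum>i = 1..d. (- 1) ^ (i - 1) * v i (d + 1 - i) (1, j))"
      by (simp add: xvec_def sum_fun_apply)
    also have "\<dots> = (\<Sum>i = 1..d. if i = 1 then act h (bvec d) j else 0)"
      by (rule sum.cong) (auto simp: vij_def tensor_def bvec_def h_def)
    finally show ?thesis using that by simp
  qed
  have "act h u = (\<Sum>d = 1..m. fscale (c d) (act h (bvec d)))"
    unfolding u_def by (rule linear_on_sum_scale[OF act_lin[OF h] subspace_Vsp]) (auto intro: bvec)
  also have "\<dots> = 0"
  proof
    fix j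
    have "(\<Sum>d = 1..m. fscale (c d) (act h (bvec d))) j = (\<Sum>d = 1..m. fscale (c d) (xvec v d)) (1, j)"
      unfolding sum_fun_apply by (rule sum.cong) (use xvec_1 in auto)
    then show "(\<Sum>d = 1..m. fscale (c d) (act h (bvec d))) j = 0 j"
      unfolding zero by simp
  qed
  finally have "act h u = 0" .
  then have "u = 0"
    using act_inverse(1)[OF h u] act_0[OF group.inv_closed[OF G h]] by metis
  have "u d = (\<Sum>d' = 1..m. if d' = d then c d' else 0)"
    unfolding u_def sum_fun_apply by (rule sum.cong) (auto simp: bvec_def)
  then show ?thesis
    using d \<open>u = 0\<close> by simp
qed

lemma funpow_Delta_Tsp:
  assumes "w \<in> Tsp r s"
  shows "(Delta ^^ e) w \<in> Tsp r s"
proof (induction e)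
  case (Suc e)
  have "Delta w \<in> Tsp r s" if "w \<in> fun_space.span {v i j | i j. i \<le> r \<and> j \<le> s}" for w
    using that
  proof (induction rule: fun_space.span_induct_alt)
    case base
    then show ?case by (simp only: Delta_0 fun_space.subspace_0[OF subspace_Tsp])
  next
    case (step c w w')
    then obtain i j where ij: "w = v i j" "i \<le> r" "j \<le> s"
      by blast
    have "v (i - 1) j + v i (j - 1) \<in> Tsp r s"
      by (intro fun_space.subspace_add[OF subspace_Tsp] v_in_Tsp; use ij in linarith)
    then have "Delta w \<in> Tsp r s"
      unfolding ij(1) Delta_v[OF ij(2,3)] .
    then have "fscale c (Delta w) \<in> Tsp r s"
      by (rule fun_space.subspace_scale[OF subspace_Tsp])
    from this step(2) show ?case
      unfolding Delta_add Delta_scale by (rule fun_space.subspace_add[OF subspace_Tsp])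
  qed
  with Suc Tsp_eq_span_v show ?case by auto
qed (use assms in simp)

end

section \<open>The dimensions of the summands\<close>

locale tensor_decomposition = tensor_module G g act q r s n
  for G :: "('g, 'm) monoid_scheme" and g :: 'g
    and act :: "'g \<Rightarrow> (nat \<Rightarrow> 'f::field) \<Rightarrow> nat \<Rightarrow> 'f" and q r s n :: nat +
  fixes m :: nat and lam :: "nat \<Rightarrow> nat"
  assumes lam: "\<And>i. i \<in> {1..m} \<Longrightarrow> 0 < lam i \<and> lam i \<le> q"
    and lam_antimono: "\<And>i j. i \<in> {1..m} \<Longrightarrow> j \<in> {1..m} \<Longrightarrow> i \<le> j \<Longrightarrow> lam j \<le> lam i"
    and iso: "FG_isomorphic G (Tsp r s) (Tact r s act) (DSsp m lam) (DSact act)"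
begin

definition \<phi> :: "(nat \<times> nat \<Rightarrow> 'f) \<Rightarrow> nat \<times> nat \<Rightarrow> 'f" where
  "\<phi> = (SOME \<phi>. bij_betw \<phi> (Tsp r s) (DSsp m lam) \<and> linear_on (Tsp r s) \<phi> \<and>
          (\<forall>h\<in>carrier G. \<forall>x\<in>Tsp r s. \<phi> (Tact r s act h x) = DSact act h (\<phi> x)))"

lemma \<phi>: "bij_betw \<phi> (Tsp r s) (DSsp m lam)" "linear_on (Tsp r s) \<phi>"
  "h \<in> carrier G \<Longrightarrow> w \<in> Tsp r s \<Longrightarrow> \<phi> (Tact r s act h w) = DSact act h (\<phi> w)"
  using someI_ex[OF iso[unfolded FG_isomorphic_def], folded \<phi>_def] by blast+

lemma \<phi>_in_DSsp: "w \<in> Tsp r s \<Longrightarrow> \<phi> w \<in> DSsp m lam"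
  using \<phi>(1) by (auto simp: bij_betw_def)

lemma \<phi>_0: "\<phi> 0 = 0"
  by (rule linear_on_0[OF \<phi>(2) subspace_Tsp])

lemma \<phi>_add: "w \<in> Tsp r s \<Longrightarrow> w' \<in> Tsp r s \<Longrightarrow> \<phi> (w + w') = \<phi> w + \<phi> w'"
  and \<phi>_scale: "w \<in> Tsp r s \<Longrightarrow> \<phi> (fscale c w) = fscale c (\<phi> w)"
  using \<phi>(2) unfolding linear_on_def by blast+

lemma DSsp_apply:
  assumes "w \<in> DSsp m lam" "\<not> (i \<in> {1..m} \<and> k \<in> {1..lam i})"
  shows "w (i, k) = 0"
  using assms by (auto simp: DSsp_def Vsp_iff)

text \<open>Through \<open>\<phi>\<close>, \<open>Delta\<close> becomes the coordinate shift in each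
  summand; the dimension counts below rest on this.\<close>

lemma \<phi>_Delta:
  assumes w: "w \<in> Tsp r s"
  shows "\<phi> (Delta w) (i, k) = (if k = 0 then 0 else \<phi> w (i, Suc k))"
proof -
  have w': "\<phi> w \<in> DSsp m lam"
    by (rule \<phi>_in_DSsp[OF w])
  have Delta: "Delta w \<in> Tsp r s"
    using funpow_Delta_Tsp[OF w, of 1] by simp
  have "Tact r s act g w = Delta w + w"
    unfolding Delta_def by (simp only: diff_add_cancel)
  then have "\<phi> (Delta w) + \<phi> w = DSact act g (\<phi> w)"
    using \<phi>_add[OF Delta w] \<phi>(3)[OF g w] by (simp only:)
  then have "\<phi> (Delta w) (i, k) + \<phi> w (i, k) = DSact act g (\<phi> w) (i, k)"
    by (metis plus_fun_apply)
  moreover have "DSact act g (\<phi> w) (i, k) = act g (\<lambda>k'. \<phi> w (i, k')) k"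
    by (simp add: DSact_def)
  moreover have "(\<lambda>k'. \<phi> w (i, k')) \<in> Vsp q"
    using DSsp_apply[OF w', of i] lam[of i] by (force simp: Vsp_iff)
  ultimately show ?thesis
    using act_g_apply[of q "\<lambda>k'. \<phi> w (i, k')" k] by simp
qed

lemma \<phi>_funpow_Delta:
  assumes w: "w \<in> Tsp r s"
  shows "\<phi> ((Delta ^^ e) w) (i, k) = (if k = 0 then 0 else \<phi> w (i, k + e))"
proof (induction e arbitrary: k)
  case 0
  then show ?case using DSsp_apply[OF \<phi>_in_DSsp[OF w], of i 0] by simp
next
  case (Suc e)
  then show ?case
    using \<phi>_Delta[OF funpow_Delta_Tsp[OF w, of e], of i k] by simp
qed

text \<open>A vector in the socle and in the image of \<open>\<Delta>\<^bsup>N-1\<^esup>\<close> only has components in the summands of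
  dimension at least \<open>N\<close>.\<close>

lemma lam_ge:
  assumes l: "1 \<le> l" "l \<le> m" "l \<le> e" and e: "e \<le> s" and "N > 0"
    and x: "\<And>d. d \<in> {1..e} \<Longrightarrow> Delta (xvec v d) = 0"
    and u: "\<And>d. d \<in> {1..e} \<Longrightarrow> u d \<in> Tsp r s \<and> (Delta ^^ (N - 1)) (u d) = xvec v d"
  shows "N \<le> lam l"
proof (rule ccontr)
  assume "\<not> N \<le> lam l"
  then have small: "lam i < N" if "i \<in> {l..m}" for i
    using lam_antimono[of l i] l that by auto
  have x_Tsp: "xvec v d \<in> Tsp r s" if "d \<in> {1..e}" for d
    using u[OF that] funpow_Delta_Tsp by metis
  \<comment> \<open>Coordinates with \<open>k \<ge> 2\<close> vanish because \<open>Delta\<close>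
    kills \<open>xvec v d\<close>. Those with \<open>k = 1\<close> and \<open>l \<le> i\<close>
    equal coordinate \<open>N\<close> of \<open>u d\<close>, which lies beyond
    \<open>lam i\<close>.\<close>
  have supp: "\<phi> (xvec v d) (i, k) = 0" if "d \<in> {1..e}" "\<not> (i \<in> {1..<l} \<and> k = 1)" for d i k
  proof (cases "k = 1 \<and> i \<in> {1..m}")
    case True
    then have "i \<in> {l..m}" using that by auto
    have "\<phi> (xvec v d) (i, k) = \<phi> (u d) (i, k + (N - 1))"
      using \<phi>_funpow_Delta[of "u d" "N - 1" i k] u[OF that(1)] True by simp
    also have "\<dots> = 0"
      using DSsp_apply[OF \<phi>_in_DSsp, of "u d" i "k + (N - 1)"] u[OF that(1)]
        small[OF \<open>i \<in> {l..m}\<close>] True by simp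
    finally show ?thesis .
  next
    case False
    show ?thesis
    proof (cases "i \<in> {1..m} \<and> k \<ge> 2")
      case True
      then show ?thesis
        using \<phi>_Delta[OF x_Tsp[OF that(1)], of i "k - 1"] x[OF that(1)] \<phi>_0 by simp
    next
      case False': False
      have "\<not> (i \<in> {1..m} \<and> k \<in> {1..lam i})"
        using False False' by auto
      then show ?thesis
        by (rule DSsp_apply[OF \<phi>_in_DSsp[OF x_Tsp[OF that(1)]]])
    qed
  qed
  \<comment> \<open>The \<open>e\<close> vectors live in \<open>l - 1\<close> coordinates, so they
    are dependent, against \<open>xvec_independent\<close>.\<close>
  have "l - 1 < e" using l by simp
  then obtain c where c: "\<exists>d<e. c d \<noteq> 0"
    and sol: "\<And>i. i < l - 1 \<Longrightarrow> (\<Sum>d<e. c d * \<phi> (xvec v (Suc d)) (Suc i, 1)) = 0"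
    by (rule homogeneous_system_nontrivial[where A = "\<lambda>i d. \<phi> (xvec v (Suc d)) (Suc i, 1)"]) blast
  let ?w = "\<Sum>d<e. fscale (c d) (xvec v (Suc d))"
  have "\<phi> ?w = (\<Sum>d<e. fscale (c d) (\<phi> (xvec v (Suc d))))"
    by (rule linear_on_sum_scale[OF \<phi>(2) subspace_Tsp]) (use x_Tsp in auto)
  also have "\<dots> = 0"
  proof
    fix ik :: "nat \<times> nat"
    obtain i k where ik: "ik = (i, k)" by fastforce
    have "(\<Sum>d<e. c d * \<phi> (xvec v (Suc d)) (i, k)) = 0"
    proof (cases "i \<in> {1..<l} \<and> k = 1")
      case True
      then show ?thesis using sol[of "i - 1"] by auto
    next
      case False
      then show ?thesis using supp by (intro sum.neutral) auto
    qed
    then show "(\<Sum>d<e. fscale (c d) (\<phi> (xvec v (Suc d)))) ik = 0 ik"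
      by (simp add: ik sum_fun_apply)
  qed
  finally have "\<phi> ?w = \<phi> 0"
    using \<phi>_0 by simp
  moreover have "?w \<in> Tsp r s" "0 \<in> Tsp r s"
    by (intro fun_space.subspace_sum fun_space.subspace_scale subspace_Tsp x_Tsp, simp)
      (rule fun_space.subspace_0[OF subspace_Tsp])
  ultimately have "?w = 0"
    using \<phi>(1) by (auto simp: bij_betw_def dest: inj_onD)
  moreover have "?w = (\<Sum>d = 1..e. fscale (c (d - 1)) (xvec v d))"
    by (rule sum.reindex_bij_witness[of _ "\<lambda>d. d - 1" Suc]) auto
  ultimately have "c (d - 1) = 0" if "d \<in> {1..e}" for d
    using xvec_independent[OF e _ that, of "\<lambda>d. c (d - 1)"] by simp
  with c show False
    by (metis Suc_le_eq atLeastAtMost_iff diff_Suc_1 le_add1 plus_1_eq_Suc)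
qed

text \<open>The dimension of \<open>T / (\<Delta> T + ker \<Delta>\<^sup>N)\<close> is the number of summands of dimension greater than \<open>N\<close>.\<close>

lemma lam_le:
  assumes l: "d < l" "l \<le> m"
    and b: "\<And>h. h < d \<Longrightarrow> b h \<in> Tsp r s"
    and v: "\<And>i j. i \<le> r \<Longrightarrow> j \<le> s \<Longrightarrow> \<exists>c u w. u \<in> Tsp r s \<and> w \<in> Tsp r s \<and> (Delta ^^ N) w = 0
      \<and> v i j = (\<Sum>h<d. fscale (c h) (b h)) + (Delta u + w)"
  shows "lam l \<le> N"
proof (rule ccontr)
  assume "\<not> lam l \<le> N"
  then have large: "N < lam i" if "i \<in> {1..l}" for i
    using lam_antimono[of i l] l that by auto
  \<comment> \<open>The coefficients of a functional on the top coordinates of the first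
    \<open>l\<close> summands that kills the \<open>d\<close> vectors \<open>b h\<close>. It will
    turn out to vanish on the whole space although some \<open>c j\<close> is nonzero.\<close>
  obtain c where c: "\<exists>j<l. c j \<noteq> 0"
    and sol: "\<And>h. h < d \<Longrightarrow> (\<Sum>j<l. c j * \<phi> (b h) (Suc j, lam (Suc j))) = 0"
    by (rule homogeneous_system_nontrivial[OF l(1), where A = "\<lambda>h j. \<phi> (b h) (Suc j, lam (Suc j))"]) blast
  define L where "L w = (\<Sum>j<l. c j * w (Suc j, lam (Suc j)))" for w :: "nat \<times> nat \<Rightarrow> 'f"
  have L_add: "L (w + w') = L w + L w'" for w w'
    by (simp add: L_def distrib_left sum.distrib)
  have L_scale: "L (fscale a w) = a * L w" for a w
    by (simp add: L_def sum_distrib_left mult_ac)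
  have L_0: "L 0 = 0"
    by (simp add: L_def)
  have L_sum: "L (\<Sum>h<d. fscale (a h) (w h)) = (\<Sum>h<d. a h * L (w h))" for a w
    by (induction d) (simp_all only: lessThan_0 sum.empty L_0 sum.lessThan_Suc L_add L_scale)
  have L_v: "L (\<phi> (v i j)) = 0" if ij: "i \<le> r" "j \<le> s" for i j
  proof -
    obtain a u w where auw: "u \<in> Tsp r s" "w \<in> Tsp r s" "(Delta ^^ N) w = 0"
      "v i j = (\<Sum>h<d. fscale (a h) (b h)) + (Delta u + w)"
      using v[OF ij] by blast
    have Du: "Delta u \<in> Tsp r s"
      using funpow_Delta_Tsp[OF auw(1), of 1] by simp
    \<comment> \<open>The top coordinate of \<open>Delta u\<close> is the coordinate of
      \<open>u\<close> just beyond the top.\<close>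
    have "L (\<phi> (Delta u)) = 0"
      unfolding L_def
    proof (rule sum.neutral, rule ballI)
      fix j assume "j \<in> {..<l}"
      have "\<phi> u (Suc j, Suc (lam (Suc j))) = 0"
        by (rule DSsp_apply[OF \<phi>_in_DSsp[OF auw(1)]]) simp
      then show "c j * \<phi> (Delta u) (Suc j, lam (Suc j)) = 0"
        using \<phi>_Delta[OF auw(1)] by simp
    qed
    \<comment> \<open>As \<open>N < lam (Suc j)\<close>, the top coordinate of \<open>w\<close>
      survives as a coordinate of \<open>(Delta ^^ N) w\<close>, which is zero.\<close>
    moreover have "L (\<phi> w) = 0"
      unfolding L_def
    proof (rule sum.neutral, rule ballI)
      fix j assume "j \<in> {..<l}"
      then have "N < lam (Suc j)"
        using large by auto
      then have "\<phi> w (Suc j, lam (Suc j)) = \<phi> ((Delta ^^ N) w) (Suc j, lam (Suc j) - N)"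
        using \<phi>_funpow_Delta[OF auw(2), of N "Suc j" "lam (Suc j) - N"] by simp
      also have "\<dots> = 0"
        unfolding auw(3) \<phi>_0 by simp
      finally show "c j * \<phi> w (Suc j, lam (Suc j)) = 0" by simp
    qed
    moreover have "L (\<phi> (\<Sum>h<d. fscale (a h) (b h))) = 0"
    proof -
      have "\<phi> (\<Sum>h<d. fscale (a h) (b h)) = (\<Sum>h<d. fscale (a h) (\<phi> (b h)))"
        by (rule linear_on_sum_scale[OF \<phi>(2) subspace_Tsp]) (use b in auto)
      moreover have "(\<Sum>h<d. a h * L (\<phi> (b h))) = 0"
        using sol by (intro sum.neutral) (auto simp: L_def)
      ultimately show ?thesis
        by (simp only: L_sum)
    qed
    moreover have "\<phi> (v i j) = \<phi> (\<Sum>h<d. fscale (a h) (b h)) + (\<phi> (Delta u) + \<phi> w)"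
    proof -
      have mem: "(\<Sum>h<d. fscale (a h) (b h)) \<in> Tsp r s" "Delta u + w \<in> Tsp r s"
        by (intro fun_space.subspace_sum fun_space.subspace_scale subspace_Tsp b, simp)
          (rule fun_space.subspace_add[OF subspace_Tsp Du auw(2)])
      show ?thesis
        unfolding auw(4) by (simp only: \<phi>_add mem Du auw(2))
    qed
    ultimately show ?thesis
      by (simp only: L_add add_0_left)
  qed
  have L_span: "L (\<phi> w) = 0 \<and> w \<in> Tsp r s" if "w \<in> fun_space.span {v i j | i j. i \<le> r \<and> j \<le> s}" for w
    using that
  proof (induction rule: fun_space.span_induct_alt)
    case base
    then show ?case
      by (simp only: \<phi>_0 L_0 fun_space.subspace_0[OF subspace_Tsp])
  next
    case (step a w w')
    then obtain i j where ij: "w = v i j" "i \<le> r" "j \<le> s"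
      by blast
    have w: "w \<in> Tsp r s" "fscale a w \<in> Tsp r s"
      unfolding ij(1) by (intro fun_space.subspace_scale[OF subspace_Tsp] v_in_Tsp ij(2,3))+
    have "\<phi> (fscale a w + w') = fscale a (\<phi> w) + \<phi> w'"
      using step(2) by (simp only: \<phi>_add \<phi>_scale w)
    then show ?case
      using step(2) L_v[OF ij(2,3)] fun_space.subspace_add[OF subspace_Tsp w(2), of w']
      unfolding ij(1) by (simp only: L_add L_scale mult_zero_right add_0_left)
  qed
  obtain j where j: "j < l" "c j \<noteq> 0" using c by blast
  define w' :: "nat \<times> nat \<Rightarrow> 'f" where "w' = (\<lambda>ik. if ik = (Suc j, lam (Suc j)) then 1 else 0)"
  have "w' \<in> DSsp m lam"
    using j(1) l(2) lam[of "Suc j"] by (auto simp: DSsp_def Vsp_iff w'_def)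
  then have "w' \<in> \<phi> ` Tsp r s"
    unfolding bij_betw_imp_surj_on[OF \<phi>(1)] .
  then obtain w where w: "w \<in> Tsp r s" "w' = \<phi> w"
    by (elim imageE)
  have "L w' = 0"
    unfolding w(2) using L_span[OF subsetD[OF Tsp_eq_span_v w(1)]] by (rule conjunct1)
  moreover have "L w' = (\<Sum>i<l. if i = j then c i else 0)"
    unfolding L_def w'_def by (rule sum.cong) auto
  ultimately show False
    using j by simp
qed

end

section \<open>Explicit lifts\<close>

text \<open>Here \<open>c\<close> stands for \<open>r\<^sub>n - t - 1\<close> and \<open>b\<close>
  for \<open>s\<^sub>n - t\<close>, which avoids truncated subtraction; the binomials have upper
  index \<open>b + c\<close>.\<close>

locale toeplitz_lift = tensor_module G g act q r s n
  for G :: "('g, 'm) monoid_scheme" and g :: 'g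
    and act :: "'g \<Rightarrow> (nat \<Rightarrow> 'f::field) \<Rightarrow> nat \<Rightarrow> 'f" and q r s n :: nat +
  fixes P b c t R S :: nat and \<zeta> :: "nat \<Rightarrow> 'f"
  assumes char: "prime CHAR('f)" and P: "P = CHAR('f) ^ n"
    and r_eq: "r = (c + t + 1) * P + R" and s_eq: "s = (b + t) * P + S"
    and RS: "R < S" "S < P" and small: "b + c + t + 1 < CHAR('f)"
    and \<zeta>: "\<And>i. i \<le> t \<Longrightarrow>
      (\<Sum>j = 0..t. binom (int (b + c)) (int c + int j - int i) * \<zeta> j) = (- 1) ^ i"
begin

definition Z :: "'f poly" where
  "Z = (\<Sum>j = 0..t. monom (\<zeta> j) (t - j))"

text \<open>In degree \<open>t P + k - 1\<close> its form is \<open>y\<close> up to sign. The degree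
  is left open, since larger ones are used for the dimensions.\<close>

definition y_poly :: "nat \<Rightarrow> 'f poly" where
  "y_poly k = monom 1 (k - 1) * pcompose Z (monom 1 P)"

definition z_poly :: "nat \<Rightarrow> 'f poly" where
  "z_poly k = monom 1 (k - 1) * pcompose (alt_sum t c) (monom 1 P)"

lemma P_pos: "P > 0"
  using RS by simp

lemma degree_Z: "degree Z \<le> t"
  unfolding Z_def by (rule degree_sum_monom_le)

lemma coeff_power_mult_Z: "i \<le> t \<Longrightarrow> coeff ([:1, 1:] ^ (b + c) * Z) (c + t - i) = (- 1) ^ i"
  unfolding Z_def using coeff_one_plus_power_mult_sum[of i t "b + c" \<zeta> c] \<zeta>[of i] by simp

lemma degree_shifted_pcompose:
  assumes "degree f \<le> e"
  shows "degree (monom 1 (k - 1) * pcompose f (monom 1 P) :: 'f poly) \<le> e * P + (k - 1)"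
proof -
  have "degree (monom 1 (k - 1) * pcompose f (monom 1 P) :: 'f poly)
      \<le> degree (monom 1 (k - 1) :: 'f poly) + degree (pcompose f (monom 1 P))"
    by (rule degree_mult_le)
  also have "degree (pcompose f (monom 1 P)) \<le> degree f * degree (monom 1 P :: 'f poly)"
    by (rule degree_pcompose_le)
  also have "\<dots> = degree f * P"
    by (simp add: degree_monom_eq)
  also have "\<dots> \<le> e * P"
    using assms by simp
  finally show ?thesis
    by (simp add: degree_monom_eq)
qed

lemma degree_y_poly: "degree (y_poly k) \<le> t * P + (k - 1)"
  unfolding y_poly_def by (rule degree_shifted_pcompose[OF degree_Z])

lemma degree_z_poly: "degree (z_poly k) \<le> (c + b + t) * P + (k - 1)"
  unfolding z_poly_def
proof (rule degree_shifted_pcompose)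
  show "degree (alt_sum t c :: 'f poly) \<le> c + b + t"
    unfolding alt_sum_def
    by (intro degree_sum_le) (auto intro: order.trans[OF degree_monom_le])
qed

text \<open>Because \<open>(-1)^P = -1\<close>, the value is \<open>Z(-1)\<close> up to
  sign.\<close>

lemma poly_y_poly_neq_0: "poly (y_poly k) (- 1) \<noteq> 0"
proof -
  have "poly Z (- 1) \<noteq> 0"
    using poly_toeplitz_solution_neq_0[of c "b + c" t Z] small degree_Z coeff_power_mult_Z by simp
  then show ?thesis
    by (simp add: y_poly_def poly_pcompose poly_monom minus_one_power_CHAR[OF char P])
qed

lemma form_eq_y_poly:
  assumes "R < k"
  shows "form_eq r s ((c + b + t) * P + (k - 1)) ([:1, 1:] ^ ((b + c) * P) * y_poly k) (z_poly k)"
proof -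
  have "[:1, 1:] ^ ((b + c) * P) * y_poly k
      = monom 1 (k - 1) * pcompose ([:1, 1:] ^ (b + c) * Z) (monom 1 P)"
    unfolding y_poly_def by (simp only: mult.left_commute one_plus_power_mult_pcompose[OF char P])
  then show ?thesis
    unfolding r_eq s_eq z_poly_def
    using form_eq_toeplitz[OF P_pos assms RS(2) coeff_power_mult_Z] by simp
qed

lemma form_eq_z_poly:
  assumes "R < k"
  shows "form_eq r s ((c + b + t) * P + (k - 1) + (P - 1)) ([:1, 1:] ^ (P - 1) * z_poly k)
    (Polynomial.smult ((- 1) ^ (R + k - 1)) (alt_poly r))"
  unfolding r_eq s_eq z_poly_def
  by (rule form_eq_alternating[OF char P]) (use assms RS in auto)

lemma funpow_Delta_y_poly:
  assumes "R < k"
  shows "(Delta ^^ ((b + c) * P)) (form (t * P + (k - 1)) (y_poly k))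
    = form ((c + b + t) * P + (k - 1)) (z_poly k)"
proof -
  have h: "t * P + (k - 1) + (b + c) * P = (c + b + t) * P + (k - 1)"
    by (simp add: algebra_simps)
  show ?thesis
    unfolding funpow_Delta_form[OF degree_y_poly] h by (rule form_cong[OF form_eq_y_poly[OF assms]])
qed

lemma funpow_Delta_z_poly:
  assumes "R < k" "k \<le> S"
  shows "(Delta ^^ (P - 1)) (form ((c + b + t) * P + (k - 1)) (z_poly k))
    = fscale ((- 1) ^ (R + k - 1)) (xvec v (t * P + R + S + 1 - k))"
proof -
  let ?d = "t * P + R + S + 1 - k"
  have d: "?d \<le> r" "?d \<le> s"
    using assms RS unfolding r_eq s_eq by (simp_all add: algebra_simps)
  have h: "(c + b + t) * P + (k - 1) + (P - 1) = r + s - 1 - ?d"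
    using assms RS unfolding r_eq s_eq by (simp add: algebra_simps)
  show ?thesis
    unfolding funpow_Delta_form[OF degree_z_poly] form_cong[OF form_eq_z_poly[OF assms(1)]] form_smult
    unfolding h xvec_eq_form[OF d] ..
qed

lemma Delta_xvec:
  assumes "d \<le> r" "d \<le> s" "0 < s"
  shows "Delta (xvec v d) = 0"
proof -
  have "degree (alt_poly r :: 'f poly) \<le> r + s - 1 - d"
    using degree_alt_poly[of r, where 'a = 'f] assms by simp
  then have "Delta (xvec v d) = form (Suc (r + s - 1 - d)) ([:1, 1:] * alt_poly r)"
    unfolding xvec_eq_form[OF assms(1,2)] by (rule Delta_form)
  also have "\<dots> = form (Suc (r + s - 1 - d)) 0"
    by (rule form_cong[OF form_eq_one_plus_mult_alt_poly]) (use assms in simp)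
  finally show ?thesis
    by (simp only: form_0)
qed

text \<open>Passing to forms of larger degree only enlarges the ideal modulo which one computes; hence
  the single polynomial \<open>y_poly (R + 1)\<close> lifts every \<open>xvec v d\<close> with \<open>d \<le> tP + S\<close>.\<close>

lemma funpow_Delta_y_poly_alt_poly:
  assumes "t * P + R \<le> h"
  shows "(Delta ^^ ((b + c + 1) * P - 1)) (form h (y_poly (R + 1)))
    = form (h + ((b + c + 1) * P - 1)) (Polynomial.smult ((- 1) ^ (R + (R + 1) - 1)) (alt_poly r))"
    (is "(Delta ^^ ?N) _ = form _ ?f")
proof -
  \<comment> \<open>The degree reached from the smallest admissible \<open>h\<close>, namely
    \<open>t P + R\<close>; \<open>form_eq_mono\<close> passes to the others.\<close>
  let ?h = "(c + b + t) * P + (R + 1 - 1) + (P - 1)"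
  have "form_eq r s ?h
      ([:1, 1:] ^ (P - 1) * ([:1, 1:] ^ ((b + c) * P) * y_poly (R + 1))) ([:1, 1:] ^ (P - 1) * z_poly (R + 1))"
    by (rule form_eq_one_plus_power[OF form_eq_y_poly]) simp
  then have "form_eq r s ?h ([:1, 1:] ^ (P - 1) * ([:1, 1:] ^ ((b + c) * P) * y_poly (R + 1))) ?f"
    by (rule form_eq_trans[OF _ form_eq_z_poly]) simp
  moreover have N: "P - 1 + (b + c) * P = ?N"
    using P_pos by (simp add: algebra_simps)
  ultimately have "form_eq r s ?h ([:1, 1:] ^ ?N * y_poly (R + 1)) ?f"
    by (simp only: power_add[symmetric] mult.assoc[symmetric])
  moreover have "?h \<le> h + ?N"
    using assms P_pos by (simp add: algebra_simps)
  ultimately have "form_eq r s (h + ?N) ([:1, 1:] ^ ?N * y_poly (R + 1)) ?f"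
    by (rule form_eq_mono)
  then have "form (h + ?N) ([:1, 1:] ^ ?N * y_poly (R + 1)) = form (h + ?N) ?f"
    by (rule form_cong)
  moreover have "degree (y_poly (R + 1)) \<le> h"
    using degree_y_poly[of "R + 1"] assms by simp
  ultimately show ?thesis
    by (simp only: funpow_Delta_form)
qed

lemma funpow_Delta_y_poly_xvec:
  assumes "t * P + R \<le> h" "h < 2 * (t * P) + R + S"
  shows "(Delta ^^ ((b + c + 1) * P - 1)) (form h (y_poly (R + 1)))
    = fscale ((- 1) ^ (R + (R + 1) - 1)) (xvec v (2 * (t * P) + R + S - h))"
proof -
  let ?d = "2 * (t * P) + R + S - h"
  have d: "?d \<le> r" "?d \<le> s"
    using assms RS unfolding r_eq s_eq by (simp_all add: algebra_simps)
  have h: "h + ((b + c + 1) * P - 1) = r + s - 1 - ?d"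
    using assms RS unfolding r_eq s_eq by (simp add: algebra_simps)
  show ?thesis
    unfolding funpow_Delta_y_poly_alt_poly[OF assms(1)] form_smult
    unfolding h xvec_eq_form[OF d] ..
qed

text \<open>One more factor \<open>X + Y\<close> kills \<open>alt_poly r\<close> in every degree
  from \<open>s\<close> on. This includes degrees too large for any \<open>xvec v d\<close> with
  \<open>d \<ge> 1\<close>.\<close>

lemma funpow_Delta_y_poly_eq_0:
  assumes "t * P + R \<le> h"
  shows "(Delta ^^ ((b + c + 1) * P)) (form h (y_poly (R + 1))) = 0"
proof -
  let ?N = "(b + c + 1) * P - 1" and ?\<sigma> = "(- 1) ^ (R + (R + 1) - 1) :: 'f"
  have N: "(b + c + 1) * P = Suc ?N"
    using P_pos by simp
  have step: "(Delta ^^ ((b + c + 1) * P)) w = Delta ((Delta ^^ ?N) w)" for w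
    using arg_cong[OF N, of "\<lambda>e. (Delta ^^ e) w"] by (simp only: funpow.simps comp_apply)
  have "degree (alt_poly r :: 'f poly) \<le> h + ?N"
    using degree_alt_poly[of r, where 'a = 'f] assms RS unfolding r_eq by (simp add: algebra_simps)
  then have "Delta (form (h + ?N) (alt_poly r)) = form (Suc (h + ?N)) ([:1, 1:] * alt_poly r)"
    by (rule Delta_form)
  also have "\<dots> = form (Suc (h + ?N)) 0"
    by (rule form_cong[OF form_eq_one_plus_mult_alt_poly])
      (use assms RS in \<open>simp add: s_eq algebra_simps\<close>)
  finally have "Delta (form (h + ?N) (alt_poly r)) = 0"
    by (simp only: form_0)
  then show ?thesis
    unfolding step funpow_Delta_y_poly_alt_poly[OF assms] form_smult Delta_scale
    by (simp only: fun_space.scale_zero_right)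
qed

end

locale toeplitz_decomposition =
  toeplitz_lift G g act q r s n P b c t R S \<zeta> + tensor_decomposition G g act q r s n "min r s" lam
  for G :: "('g, 'm) monoid_scheme" and g :: 'g
    and act :: "'g \<Rightarrow> (nat \<Rightarrow> 'f::field) \<Rightarrow> nat \<Rightarrow> 'f" and q r s n P b c t R S \<zeta> lam
begin

lemma lam_eq:
  assumes l: "t * P + R < l" "l \<le> t * P + S" "l \<le> min r s"
  shows "lam l = (b + c + 1) * P"
proof (rule antisym)
  let ?\<sigma> = "(- 1) ^ (R + (R + 1) - 1) :: 'f"
  have \<sigma>: "?\<sigma> * ?\<sigma> = 1"
    by (rule minus_one_mult_self)
  show "(b + c + 1) * P \<le> lam l"
  \<comment> \<open>The degree is chosen so that \<open>Delta\<close> raised to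
    \<open>(b + c + 1) P - 1\<close> ends at \<open>xvec v d\<close>; the scalar cancels the
    sign.\<close>
  proof (rule lam_ge[where e = "t * P + S" and u = "\<lambda>d. fscale ?\<sigma> (form (2 * (t * P) + R + S - d) (y_poly (R + 1)))"])
    fix d assume d: "d \<in> {1..t * P + S}"
    then have "d \<le> r" "d \<le> s" "0 < s"
      using RS unfolding r_eq s_eq by (auto simp: algebra_simps)
    then show "Delta (xvec v d) = 0"
      by (rule Delta_xvec)
    let ?h = "2 * (t * P) + R + S - d"
    have h: "t * P + R \<le> ?h" "?h < 2 * (t * P) + R + S" "2 * (t * P) + R + S - ?h = d"
      using d by auto
    have "(Delta ^^ ((b + c + 1) * P - 1)) (fscale ?\<sigma> (form ?h (y_poly (R + 1)))) = xvec v d"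
      unfolding funpow_Delta_scale funpow_Delta_y_poly_xvec[OF h(1,2)] h(3) fun_space.scale_scale \<sigma>
      by (rule fun_space.scale_one)
    then show "fscale ?\<sigma> (form ?h (y_poly (R + 1))) \<in> Tsp r s \<and>
        (Delta ^^ ((b + c + 1) * P - 1)) (fscale ?\<sigma> (form ?h (y_poly (R + 1)))) = xvec v d"
      using fun_space.subspace_scale[OF subspace_Tsp form_in_Tsp] by blast
  qed (use l P_pos in \<open>auto simp: s_eq algebra_simps\<close>)
  show "lam l \<le> (b + c + 1) * P"
  \<comment> \<open>The vectors \<open>form h 1\<close> are the powers \<open>Y^h\<close>; those
    with \<open>h < t P + R\<close> are kept as the spanning set.\<close>
  proof (rule lam_le[where d = "t * P + R" and b = "\<lambda>h. form h 1"])
    fix i j assume ij: "i \<le> r" "j \<le> s"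
    define h where "h = (r - i) + (s - j)"
    have "form h (monom 1 (r - i)) = fscale 1 (v (r - (r - i)) (s - (h - (r - i))))"
      by (rule form_monom) (simp add: h_def)
    then have v_eq: "v i j = form h (monom 1 (r - i))"
      using ij by (simp only: h_def fun_space.scale_one add_diff_cancel_left' diff_diff_cancel)
    have "degree (monom 1 (r - i) :: 'f poly) \<le> h"
      by (simp add: degree_monom_eq h_def)
    then obtain a u where u: "u \<in> Tsp r s" "v i j = fscale a (form h 1) + Delta u"
      using form_mod_Delta unfolding v_eq by blast
    show "\<exists>c' u w. u \<in> Tsp r s \<and> w \<in> Tsp r s \<and> (Delta ^^ ((b + c + 1) * P)) w = 0
      \<and> v i j = (\<Sum>h<t * P + R. fscale (c' h) (form h 1)) + (Delta u + w)"
    proof (cases "h < t * P + R")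
      case True
      let ?c = "\<lambda>h'. if h' = h then a else 0"
      have "(\<Sum>h'<t * P + R. fscale (?c h') (form h' 1)) = (\<Sum>h'<t * P + R. if h' = h then fscale a (form h 1) else 0)"
      proof (rule sum.cong[OF refl])
        show "fscale (?c h') (form h' 1) = (if h' = h then fscale a (form h 1) else 0)" for h'
          by (cases "h' = h") (simp_all only: if_True if_False simp_thms fun_space.scale_zero_left)
      qed
      also have "\<dots> = fscale a (form h 1)"
        using True by (simp only: sum.delta finite_lessThan lessThan_iff if_True)
      finally have "v i j = (\<Sum>h'<t * P + R. fscale (?c h') (form h' 1)) + (Delta u + 0)"
        unfolding u(2) by (simp only: add_0_right)
      then show ?thesis
        by (intro exI[of _ ?c] exI[of _ u] exI[of _ 0] conjI u(1) funpow_Delta_0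
            fun_space.subspace_0[OF subspace_Tsp])
    next
      case False
      let ?y = "y_poly (R + 1)"
      define \<alpha> where "\<alpha> = poly ?y (- 1)"
      have \<alpha>: "\<alpha> \<noteq> 0"
        unfolding \<alpha>_def by (rule poly_y_poly_neq_0)
      have "degree ?y \<le> h"
        using degree_y_poly[of "R + 1"] False by simp
      then obtain u' where u': "u' \<in> Tsp r s" "form h ?y = fscale \<alpha> (form h 1) + Delta u'"
        using form_mod_Delta unfolding \<alpha>_def by blast
      \<comment> \<open>Since \<open>\<alpha>\<close> is nonzero, \<open>Y^h\<close> can be solved
        for: a multiple of the form of \<open>?y\<close>, in the kernel, minus an element of the
        image of \<open>Delta\<close>.\<close>
      let ?u = "u + fscale (- (a / \<alpha>)) u'" and ?w = "fscale (a / \<alpha>) (form h ?y)"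
      have "(Delta ^^ ((b + c + 1) * P)) ?w = 0"
        unfolding funpow_Delta_scale using funpow_Delta_y_poly_eq_0[of h] False
        by (simp only: not_less fun_space.scale_zero_right)
      moreover have "v i j = (\<Sum>h<t * P + R. fscale 0 (form h 1)) + (Delta ?u + ?w)"
      proof
        fix x
        show "v i j x = ((\<Sum>h<t * P + R. fscale 0 (form h 1)) + (Delta ?u + ?w)) x"
          unfolding u(2) u'(2) Delta_add Delta_scale using \<alpha>
          by (simp add: sum_fun_apply field_simps)
      qed
      moreover have "?u \<in> Tsp r s" "?w \<in> Tsp r s"
        by (intro fun_space.subspace_add fun_space.subspace_scale subspace_Tsp u u' form_in_Tsp)+
      ultimately show ?thesis
        by (intro exI[of _ "\<lambda>_. 0"] exI[of _ ?u] exI[of _ ?w] conjI)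
    qed
  qed (use l form_in_Tsp in \<open>auto\<close>)
qed

end

theorem proposition4:
  fixes p a q n r s r\<^sub>n s\<^sub>n R S l t k :: nat
    and G :: "('g, 'm) monoid_scheme" and g :: 'g
    and act :: "'g \<Rightarrow> (nat \<Rightarrow> 'f::field) \<Rightarrow> nat \<Rightarrow> 'f"
    and lam :: "nat \<Rightarrow> nat"
    and v :: "nat \<Rightarrow> nat \<Rightarrow> nat \<times> nat \<Rightarrow> 'f"
    and D :: "nat \<Rightarrow> (nat \<times> nat \<Rightarrow> 'f) set"
    and x :: "nat \<Rightarrow> nat \<times> nat \<Rightarrow> 'f"
    and \<Delta> :: "(nat \<times> nat \<Rightarrow> 'f) \<Rightarrow> nat \<times> nat \<Rightarrow> 'f"
    and P X \<zeta> :: "'f mat"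
    and y z :: "nat \<times> nat \<Rightarrow> 'f"
  assumes "prime p" and "CHAR('f) = p"
    and "a > 0" and "q = p ^ a"
    and "group G" and "g \<in> carrier G" and "generate G {g} = carrier G" and "Coset.order G = q"
    and "FG_module G (Vsp q) act"
    and "act g (bvec 1) = bvec 1"
    and "\<forall>i\<in>{1<..q}. act g (bvec i) = bvec (i - 1) + bvec i"
    and "1 \<le> r" "r \<le> q" "1 \<le> s" "s \<le> q"
    and "\<forall>i\<in>{1..min r s}. 0 < lam i \<and> lam i \<le> q"
    and "\<forall>i\<in>{1..min r s}. \<forall>j\<in>{1..min r s}. i \<le> j \<longrightarrow> lam j \<le> lam i"
    and "FG_isomorphic G (Tsp r s) (Tact r s act) (DSsp (min r s) lam) (DSact act)"
    and "p ^ n \<le> max r s" and "max r s < p ^ (n + 1)"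
    and "r = r\<^sub>n * p ^ n + R" and "r\<^sub>n < p" and "R < p ^ n"
    and "s = s\<^sub>n * p ^ n + S" and "s\<^sub>n < p" and "S < p ^ n"
    and "l = t * p ^ n + k" and "1 \<le> k" and "k \<le> p ^ n"
    and "max (int r + int s - int (p ^ (n + 1))) 0 + 1 \<le> int l" and "l \<le> min r s"
    and "min R S > 0"
    and "R < S"
    and "int t \<le> min (int r\<^sub>n - 1) (int s\<^sub>n)"
    and "R + 1 \<le> k" and "k \<le> S"
  defines "v \<equiv> vij G g act n"
    and "D \<equiv> Dsp v r s"
    and "x \<equiv> xvec v"
    and "\<Delta> \<equiv> (\<lambda>w. Tact r s act g w - w)"
    and "z \<equiv> fscale ((- 1) ^ R) (\<Sum>i = 0..t. fscale ((- 1) ^ (i + k - 1))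
           (v ((i + 1) * p ^ n + R + 1 - k) ((t - i) * p ^ n + S)))"
    and "P \<equiv> mat (t + 1) (t + 1) (\<lambda>(i, j).
           binom (int r\<^sub>n + int s\<^sub>n - 2 * int t - 1) (int r\<^sub>n - int t + int j - int i - 1))"
    and "X \<equiv> mat (t + 1) 1 (\<lambda>(i, _). (- 1) ^ i)"
    and "\<zeta> \<equiv> the (mat_inverse P) * X"
    and "y \<equiv> fscale ((- 1) ^ (R + k - 1)) (\<Sum>i = 0..t. fscale (\<zeta> $$ (i, 0))
           (v ((r\<^sub>n - t + i) * p ^ n + R + 1 - k) ((s\<^sub>n - i) * p ^ n + S)))"
  shows "lam l = (r\<^sub>n + s\<^sub>n - 2 * t) * p ^ n
    \<and> (\<Delta> ^^ ((r\<^sub>n + s\<^sub>n - 2 * t - 1) * p ^ n)) ` D ((r\<^sub>n + s\<^sub>n - t) * p ^ n + R + S - k)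
        \<subseteq> D ((t + 1) * p ^ n + R + S - k)
    \<and> (z \<in> D ((t + 1) * p ^ n + R + S - k)
        \<and> (\<Delta> ^^ (p ^ n - 1)) z = x (t * p ^ n + R + S + 1 - k))
    \<and> (invertible_mat P
        \<and> y \<in> D ((r\<^sub>n + s\<^sub>n - t) * p ^ n + R + S - k)
        \<and> (\<Delta> ^^ ((r\<^sub>n + s\<^sub>n - 2 * t - 1) * p ^ n)) y = z)"
proof -
  note A = assms(1-36)
  \<comment> \<open>The bound on \<open>t\<close> makes both subtractions exact.\<close>
  define c where "c = r\<^sub>n - 1 - t"
  define b where "b = s\<^sub>n - t"
  have rn: "r\<^sub>n = c + t + 1" and sn: "s\<^sub>n = b + t"
    using A(34) by (auto simp: c_def b_def)
  define Q where "Q = p ^ n"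
  have RS: "R < S" "S < Q" and k: "R < k" "k \<le> S"
    using A by (auto simp: Q_def)
  have r_eq: "r = (c + t + 1) * Q + R" and s_eq: "s = (b + t) * Q + S"
    using A(21,24) by (simp_all add: rn sn Q_def)
  have l: "t * Q + R < l" "l \<le> t * Q + S" "l \<le> min r s"
    using A(27,31) k by (simp_all add: Q_def)
  have char: "prime CHAR('f)" "Q = CHAR('f) ^ n"
    using A(1,2) by (simp_all add: Q_def)
  \<comment> \<open>The lower bound on \<open>l\<close> gives
    \<open>(b + c + t + 1) Q + R + S + 1 \<le> p Q + k\<close>, and \<open>k \<le> S\<close> makes
    this strict before \<open>Q\<close> is cancelled.\<close>
  have small: "b + c + t + 1 < CHAR('f)"
  proof -
    have "int r + int s - int (p * Q) + 1 \<le> int l"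
      using A(30) by (simp add: Q_def)
    then have "r + s + 1 \<le> l + p * Q"
      by linarith
    then have "Q * (b + c + t + 1) < Q * p"
      using A(27) k unfolding r_eq s_eq Q_def[symmetric] by (simp add: algebra_simps)
    then have "b + c + t + 1 < p"
      by (simp only: mult_less_cancel1)
    then show ?thesis
      using A(2) by simp
  qed
  have exps: "r\<^sub>n + s\<^sub>n - 2 * t = b + c + 1" "r\<^sub>n + s\<^sub>n - 2 * t - 1 = b + c" "r\<^sub>n + s\<^sub>n - t = b + c + t + 1"
    by (simp_all add: rn sn)
  have P_eq: "P = mat (t + 1) (t + 1) (\<lambda>(i, j). binom (int (b + c)) (int c + int j - int i))"
    unfolding P_def
    by (rule cong_mat) (simp_all add: rn sn algebra_simps)
  have "det P \<noteq> 0"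
    unfolding P_eq by (rule det_binom_toeplitz_neq_0) (use small in auto)
  moreover have "P \<in> carrier_mat (t + 1) (t + 1)" "X \<in> carrier_mat (t + 1) 1"
    by (simp_all add: P_def X_def)
  ultimately have solution: "invertible_mat P" "P * \<zeta> = X" "\<zeta> \<in> carrier_mat (t + 1) 1"
    unfolding \<zeta>_def using mat_inverse_solution by blast+
  have \<zeta>_sol: "(\<Sum>j = 0..t. binom (int (b + c)) (int c + int j - int i) * \<zeta> $$ (j, 0)) = (- 1) ^ i"
    if "i \<le> t" for i
  proof -
    have "(\<Sum>j = 0..t. binom (int (b + c)) (int c + int j - int i) * \<zeta> $$ (j, 0)) = (P * \<zeta>) $$ (i, 0)"
      using that solution(3) unfolding P_eq
      by (simp add: scalar_prod_def atLeastLessThanSuc_atLeastAtMost)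
    also have "\<dots> = (- 1) ^ i"
      unfolding solution(2) using that by (simp add: X_def)
    finally show ?thesis .
  qed
  have act_Suc: "\<And>i. i \<in> {1<..q} \<Longrightarrow> act g (bvec i) = bvec (i - 1) + bvec i"
    and lam: "\<And>i. i \<in> {1..min r s} \<Longrightarrow> 0 < lam i \<and> lam i \<le> q"
    and lam_antimono: "\<And>i j. i \<in> {1..min r s} \<Longrightarrow> j \<in> {1..min r s} \<Longrightarrow> i \<le> j \<Longrightarrow> lam j \<le> lam i"
    using A(11,16,17) by blast+
  interpret toeplitz_decomposition G g act q r s n Q b c t R S "\<lambda>j. \<zeta> $$ (j, 0)" lam
    by (intro toeplitz_decomposition.intro toeplitz_lift.intro tensor_decomposition.intro
        tensor_module.intro jordan_module.intro toeplitz_lift_axioms.intro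
        tensor_decomposition_axioms.intro tensor_module_axioms.intro)
      (fact A(5) A(6) A(7) A(9) A(10) act_Suc A(13) A(15) lam lam_antimono A(18)
        char r_eq s_eq RS small \<zeta>_sol)+
  have \<Delta>: "\<Delta> = Delta"
    by (simp add: \<Delta>_def Delta_def fun_eq_iff)
  have vD: "D d = Dsp (vij G g act n) r s d" for d
    by (simp only: D_def v_def)
  \<comment> \<open>The sign of both \<open>y\<close> and \<open>z\<close> relative to their
    polynomials. It cancels against the same sign in \<open>funpow_Delta_z_poly\<close>.\<close>
  define \<sigma> :: 'f where "\<sigma> = (- 1) ^ (R + k - 1)"
  have \<sigma>: "\<sigma> * \<sigma> = 1"
    unfolding \<sigma>_def by (rule minus_one_mult_self)
  have z_eq: "z = fscale \<sigma> (form ((c + b + t) * Q + (k - 1)) (z_poly k))"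
  proof -
    have "z_poly k = (\<Sum>i = 0..t. monom ((- 1) ^ i) (k - 1 + Q * (c + t - i)))"
      by (simp add: z_poly_def alt_sum_def pcompose_sum pcompose_monom sum_distrib_left mult_monom)
    then have "form ((c + b + t) * Q + (k - 1)) (z_poly k)
        = (\<Sum>i = 0..t. form ((c + b + t) * Q + (k - 1)) (monom ((- 1) ^ i) (k - 1 + Q * (c + t - i))))"
      by (simp only: form_sum)
    also have "\<dots> = (\<Sum>i = 0..t. fscale ((- 1) ^ i) (v ((i + 1) * Q + R + 1 - k) ((t - i) * Q + S)))"
    proof (rule sum.cong[OF refl])
      fix i assume "i \<in> {0..t}"
      \<comment> \<open>Writing \<open>t = i + j\<close> removes the truncated subtractions from the
        index arithmetic.\<close>
      then obtain j where j: "t = i + j"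
        by (auto simp: le_iff_add)
      have 1: "k - 1 + Q * (c + t - i) \<le> (c + b + t) * Q + (k - 1)"
        unfolding j by (simp add: algebra_simps)
      have 2: "r - (k - 1 + Q * (c + t - i)) = (i + 1) * Q + R + 1 - k"
        using k unfolding r_eq j by (simp add: algebra_simps)
      have 3: "s - ((c + b + t) * Q + (k - 1) - (k - 1 + Q * (c + t - i))) = (t - i) * Q + S"
        unfolding s_eq j by (simp add: algebra_simps)
      show "form ((c + b + t) * Q + (k - 1)) (monom ((- 1) ^ i) (k - 1 + Q * (c + t - i)))
          = fscale ((- 1) ^ i) (v ((i + 1) * Q + R + 1 - k) ((t - i) * Q + S))"
        unfolding form_monom[OF 1] 2 3 v_def ..
    qed
    finally have form: "form ((c + b + t) * Q + (k - 1)) (z_poly k) = \<dots>" .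
    have sgn: "(- 1) ^ R * (- 1) ^ (i + k - 1) = \<sigma> * (- 1) ^ i" for i
    proof -
      have "R + (i + k - 1) = (R + k - 1) + i"
        using k by simp
      then show ?thesis
        unfolding \<sigma>_def by (simp only: power_add[symmetric])
    qed
    show ?thesis
      unfolding form z_def Q_def[symmetric] fun_space.scale_sum_right fun_space.scale_scale sgn ..
  qed
  have y_eq: "y = fscale \<sigma> (form (t * Q + (k - 1)) (y_poly k))"
  proof -
    have "y_poly k = (\<Sum>i = 0..t. monom (\<zeta> $$ (i, 0)) (k - 1 + Q * (t - i)))"
      by (simp add: y_poly_def Z_def pcompose_sum pcompose_monom sum_distrib_left mult_monom)
    then have "form (t * Q + (k - 1)) (y_poly k)
        = (\<Sum>i = 0..t. form (t * Q + (k - 1)) (monom (\<zeta> $$ (i, 0)) (k - 1 + Q * (t - i))))"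
      by (simp only: form_sum)
    also have "\<dots> = (\<Sum>i = 0..t. fscale (\<zeta> $$ (i, 0))
        (v ((r\<^sub>n - t + i) * Q + R + 1 - k) ((s\<^sub>n - i) * Q + S)))"
    proof (rule sum.cong[OF refl])
      fix i assume "i \<in> {0..t}"
      then obtain j where j: "t = i + j"
        by (auto simp: le_iff_add)
      have 1: "k - 1 + Q * (t - i) \<le> t * Q + (k - 1)"
        unfolding j by (simp add: algebra_simps)
      have 2: "r - (k - 1 + Q * (t - i)) = (r\<^sub>n - t + i) * Q + R + 1 - k"
        using k unfolding r_eq rn j by (simp add: algebra_simps)
      have 3: "s - (t * Q + (k - 1) - (k - 1 + Q * (t - i))) = (s\<^sub>n - i) * Q + S"
        unfolding s_eq sn j by (simp add: algebra_simps)
      show "form (t * Q + (k - 1)) (monom (\<zeta> $$ (i, 0)) (k - 1 + Q * (t - i)))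
          = fscale (\<zeta> $$ (i, 0)) (v ((r\<^sub>n - t + i) * Q + R + 1 - k) ((s\<^sub>n - i) * Q + S))"
        unfolding form_monom[OF 1] 2 3 v_def ..
    qed
    finally show ?thesis
      unfolding y_def Q_def[symmetric] \<sigma>_def by simp
  qed
  \<comment> \<open>The first equation counts applications of \<open>Delta\<close>; the others are
    instances of \<open>h + d + 1 = r + s\<close>, which places a form of degree \<open>h\<close> in
    \<open>D d\<close>.\<close>
  have degs: "(t + 1) * Q + R + S - k + (b + c) * Q = (b + c + t + 1) * Q + R + S - k"
    "(c + b + t) * Q + (k - 1) + ((t + 1) * Q + R + S - k) + 1 = r + s"
    "t * Q + (k - 1) + ((b + c + t + 1) * Q + R + S - k) + 1 = r + s"
    using k unfolding r_eq s_eq by (simp_all add: algebra_simps)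
  have lam_l: "lam l = (b + c + 1) * Q"
    by (rule lam_eq[OF l])
  have image: "(Delta ^^ ((b + c) * Q)) ` D ((b + c + t + 1) * Q + R + S - k) \<subseteq> D ((t + 1) * Q + R + S - k)"
    unfolding vD by (rule image_subsetI, rule funpow_Delta_Dsp, unfold degs(1))
  have z_D: "z \<in> D ((t + 1) * Q + R + S - k)"
    unfolding vD z_eq form_smult[symmetric] by (rule form_in_Dsp[OF degs(2)])
  have z_lift: "(Delta ^^ (Q - 1)) z = x (t * Q + R + S + 1 - k)"
    unfolding z_eq funpow_Delta_scale funpow_Delta_z_poly[OF k] \<sigma>_def[symmetric] fun_space.scale_scale \<sigma>
      fun_space.scale_one x_def v_def by (rule refl)
  have y_D: "y \<in> D ((b + c + t + 1) * Q + R + S - k)"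
    unfolding vD y_eq form_smult[symmetric] by (rule form_in_Dsp[OF degs(3)])
  have y_lift: "(Delta ^^ ((b + c) * Q)) y = z"
    unfolding y_eq z_eq funpow_Delta_scale funpow_Delta_y_poly[OF k(1)] by (rule refl)
  show ?thesis
    unfolding exps Q_def[symmetric] \<Delta> add_diff_cancel_right'
    by (intro conjI lam_l image z_D z_lift solution(1) y_D y_lift)
qed

end
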